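(* For every connected graph $G$ with $n$ vertices and every integer $m>0$, \[(-1)^{n}\hbar_G(-m)=\sum_c\beta(c),\] where the sum ranges over all $m$-colorings $c$ of $G$ and $\beta(c)$ is the number of nonconstant vertex orientations of $G$ compatible with $c$.
   Context: A graph $G=(V,E)$ has a finite vertex set $V$ and an edge set $E$ that is a collection of $2$-element subsets of $V$. For a positive integer $m$, an $m$-coloring of $G$ is a labeling $c$ of the vertices of $G$ with values from $\{1,\dots,m\}$. An $m$-coloring $c$ is nowhere harmonic if for every vertex $v$ of $G$, the value $c(v)$ is not equal to the average value of $c(w)$, where the average is taken over all $w$ that are neighbors of $v$. For $m\ge 1$, $\hbar_G(m)$ denotes the number of nowhere-harmonic $m$-colorings of $G$. A quasipolynomial is a function $f(m)$ defined on $\mathbb{Z}$ such that there exist a positive integer $k$ and polynomials $p_1(m),\dots,p_k(m)$ such that $f(m)=p_j(m)$ whenever $m\equiv j\bmod k$. For connected $G$, $\hbar_G(m)$ is given by a quasipolynomial in $m$, and $\hbar_G(-m)$ denotes the value of this quasipolynomial at $-m$. Given a coloring $c$ of $G$ and a vertex $v$ of $G$ of degree $d_v$, $c$ is subharmonic at $v$ if $c(v)\le \frac{1}{d_v}\sum_{\{v,w\}\in E}c(w)$, and superharmonic at $v$ if $c(v)\ge \frac{1}{d_v}\sum_{\{v,w\}\in E}c(w)$. A vertex orientation of $G$ is a $\pm 1$-labeling $\varepsilon$ of the vertices of $G$; it is nonconstant if it is neither the all-ones labeling nor the all-negative-ones labeling. A coloring $c$ is compatible with a vertex orientation $\varepsilon$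 if $c$ is subharmonic at $v$ when $\varepsilon(v)=1$ and superharmonic at $v$ when $\varepsilon(v)=-1$. *)

theory Defs
  imports
    Complex_Main
    "HOL-Library.FuncSet"
    "HOL-Number_Theory.Cong"
    "HOL-Computational_Algebra.Polynomial"
begin

definition finite_graph :: "'a set \<Rightarrow> 'a set set \<Rightarrow> bool" where
  "finite_graph V E \<longleftrightarrow> finite V \<and> (\<forall>e\<in>E. e \<subseteq> V \<and> card e = 2)"

text \<open>The graph without vertices does not count as connected.\<close>

definition connected_graph :: "'a set \<Rightarrow> 'a set set \<Rightarrow> bool" where
  "connected_graph V E \<longleftrightarrow>
     V \<noteq> {} \<and> (\<forall>u\<in>V. \<forall>v\<in>V. (\<lambda>x y. {x, y} \<in> E)\<^sup>*\<^sup>* u v)"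

definition neighbors :: "'a set set \<Rightarrow> 'a \<Rightarrow> 'a set" where
  "neighbors E v = {w. {v, w} \<in> E}"

text \<open>
  Colorings are extensional functions, so that two labelings that agree
  on \<open>V\<close> are not counted separately; likewise for vertex orientations.
\<close>

definition colorings :: "'a set \<Rightarrow> nat \<Rightarrow> ('a \<Rightarrow> nat) set" where
  "colorings V m = V \<rightarrow>\<^sub>E {1..m}"

text \<open>
  An isolated vertex has no neighbors to average over. By convention the average there is the
  value \<open>c v\<close> itself, so that \<open>c v = neighbor_average E c v\<close> is equivalent to the Laplacian
  equation, degree of \<open>v\<close> times \<open>c v\<close> equals the sum over the neighbors, at all vertices. Among
  connected graphs this concerns only the one-vertex graph, which then has no
  nowhere-harmonic coloring.
\<close>

definition neighbor_average :: "'a set set \<Rightarrow> ('a \<Rightarrow> nat) \<Rightarrow> 'a \<Rightarrow> real" where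
  "neighbor_average E c v =
     (if neighbors E v = {} then real (c v)
      else (\<Sum>w\<in>neighbors E v. real (c w)) / real (card (neighbors E v)))"

definition nowhere_harmonic :: "'a set \<Rightarrow> 'a set set \<Rightarrow> ('a \<Rightarrow> nat) \<Rightarrow> bool" where
  "nowhere_harmonic V E c \<longleftrightarrow> (\<forall>v\<in>V. real (c v) \<noteq> neighbor_average E c v)"

definition hbar :: "'a set \<Rightarrow> 'a set set \<Rightarrow> nat \<Rightarrow> nat" where
  "hbar V E m = card {c \<in> colorings V m. nowhere_harmonic V E c}"

definition quasipolynomial :: "(int \<Rightarrow> real) \<Rightarrow> bool" where
  "quasipolynomial f \<longleftrightarrow>
     (\<exists>k>0. \<exists>p :: nat \<Rightarrow> real poly. \<forall>j\<in>{1..k}. \<forall>m.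
        [m = int j] (mod int k) \<longrightarrow> f m = poly (p j) (of_int m))"

lemma quasipolynomial_eqI:
  assumes "quasipolynomial f" "quasipolynomial g"
    and eq: "\<And>m::nat. m \<ge> 1 \<Longrightarrow> f (int m) = g (int m)"
  shows "f = g"
proof
  fix x :: int
  from assms(1) obtain k p where k: "k > 0"
    and p: "\<And>j m. j \<in> {1..k} \<Longrightarrow> [m = int j] (mod int k) \<Longrightarrow> f m = poly (p j) (of_int m)"
    unfolding quasipolynomial_def by blast
  from assms(2) obtain l q where l: "l > 0"
    and q: "\<And>j m. j \<in> {1..l} \<Longrightarrow> [m = int j] (mod int l) \<Longrightarrow> g m = poly (q j) (of_int m)"
    unfolding quasipolynomial_def by blast
  have rep: "\<exists>j\<in>{1..r}. [x = int j] (mod int r)" if r: "r > 0" for r :: nat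
  proof (cases "x mod int r = 0")
    case True
    then show ?thesis using r by (intro bexI[of _ r]) (auto simp: cong_def)
  next
    case False
    have "x mod int r > 0" "x mod int r < int r"
      using False r pos_mod_sign[of "int r" x] pos_mod_bound[of "int r" x] by linarith+
    then show ?thesis by (intro bexI[of _ "nat (x mod int r)"]) (simp_all add: cong_def nat_le_iff)
  qed
  obtain i where i: "i \<in> {1..k}" "[x = int i] (mod int k)" using rep[OF k] by blast
  obtain j where j: "j \<in> {1..l}" "[x = int j] (mod int l)" using rep[OF l] by blast
  define y where "y t = x + int t * (int k * int l)" for t :: nat
  have fy: "f (y t) = poly (p i) (of_int (y t))" for t
  proof (rule p[OF i(1)])
    have "y t = x + int k * (int t * int l)" by (simp add: y_def)
    then show "[y t = int i] (mod int k)" using i(2) by (simp add: cong_def)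
  qed
  have gy: "g (y t) = poly (q j) (of_int (y t))" for t
  proof (rule q[OF j(1)])
    have "y t = x + int l * (int t * int k)" by (simp add: y_def)
    then show "[y t = int j] (mod int l)" using j(2) by (simp add: cong_def)
  qed
  have "inj_on (\<lambda>t. real_of_int (y t)) {nat \<bar>x\<bar> + 1..}"
    using k l by (simp add: inj_on_def y_def)
  then have inf: "infinite ((\<lambda>t. real_of_int (y t)) ` {nat \<bar>x\<bar> + 1..})"
    by (simp add: finite_image_iff infinite_Ici)
  have "poly (p i - q j) (real_of_int (y t)) = 0" if t: "t \<ge> nat \<bar>x\<bar> + 1" for t
  proof -
    have "int k * int l \<ge> 1" using k l zero_less_mult_iff[of "int k" "int l"] by linarith
    then have "int t * (int k * int l) \<ge> int t * 1" by (intro mult_left_mono) auto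
    then have "y t \<ge> 1" using t unfolding y_def by linarith
    then have "f (y t) = g (y t)" using eq[of "nat (y t)"] by simp
    then show ?thesis using fy gy by simp
  qed
  then have "(\<lambda>t. real_of_int (y t)) ` {nat \<bar>x\<bar> + 1..} \<subseteq> {z. poly (p i - q j) z = 0}" by auto
  then have "p i - q j = 0"
    using inf poly_roots_finite[of "p i - q j"] finite_subset by blast
  then show "f x = g x" using fy[of 0] gy[of 0] by (simp add: y_def)
qed

text \<open>
  The quasipolynomial that counts nowhere-harmonic colorings at positive arguments; by
  \<open>quasipolynomial_eqI\<close> there is at most one.
\<close>

definition hbar_quasi :: "'a set \<Rightarrow> 'a set set \<Rightarrow> int \<Rightarrow> real" where
  "hbar_quasi V E =
     (THE f. quasipolynomial f \<and> (\<forall>m::nat. m \<ge> 1 \<longrightarrow> f (int m) = real (hbar V E m)))"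

definition subharmonic_at :: "'a set set \<Rightarrow> ('a \<Rightarrow> nat) \<Rightarrow> 'a \<Rightarrow> bool" where
  "subharmonic_at E c v \<longleftrightarrow> real (c v) \<le> neighbor_average E c v"

definition superharmonic_at :: "'a set set \<Rightarrow> ('a \<Rightarrow> nat) \<Rightarrow> 'a \<Rightarrow> bool" where
  "superharmonic_at E c v \<longleftrightarrow> real (c v) \<ge> neighbor_average E c v"

definition vertex_orientations :: "'a set \<Rightarrow> ('a \<Rightarrow> int) set" where
  "vertex_orientations V = V \<rightarrow>\<^sub>E {1, -1}"

definition nonconstant :: "'a set \<Rightarrow> ('a \<Rightarrow> int) \<Rightarrow> bool" where
  "nonconstant V \<epsilon> \<longleftrightarrow> \<not> (\<forall>v\<in>V. \<epsilon> v = 1) \<and> \<not> (\<forall>v\<in>V. \<epsilon> v = -1)"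

definition compatible :: "'a set \<Rightarrow> 'a set set \<Rightarrow> ('a \<Rightarrow> nat) \<Rightarrow> ('a \<Rightarrow> int) \<Rightarrow> bool" where
  "compatible V E c \<epsilon> \<longleftrightarrow>
     (\<forall>v\<in>V. (\<epsilon> v = 1 \<longrightarrow> subharmonic_at E c v) \<and> (\<epsilon> v = -1 \<longrightarrow> superharmonic_at E c v))"

definition beta :: "'a set \<Rightarrow> 'a set set \<Rightarrow> ('a \<Rightarrow> nat) \<Rightarrow> nat" where
  "beta V E c = card {\<epsilon> \<in> vertex_orientations V. nonconstant V \<epsilon> \<and> compatible V E c \<epsilon>}"

end

theory Submission imports Defs begin

text \<open>
  Let \<open>L\<close> be the graph Laplacian. A coloring is nowhere harmonic iff \<open>L\<close> does not vanish on it at any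
  vertex. Sorting these colorings by the signs of \<open>L\<close> gives one class for each vertex orientation,
  and the constant orientations give empty classes because the values of \<open>L\<close> sum to 0. Each class
  consists of the interior lattice points of a dilated rational polytope, while the colorings
  compatible with the orientation are the lattice points of the closed polytope, with another
  dilation factor. The theorem is Ehrhart-Macdonald reciprocity, summed over the nonconstant
  orientations (\<open>region_reciprocity\<close>, \<open>hbar_eq_sum_region\<close>, \<open>sum_beta_eq_sum_region\<close>).

  Reciprocity holds only for polytopes with interior points, so that each nonconstant pattern of
  signs has to be realized by some function (\<open>laplacian_sign_pattern\<close>). This is where connectedness
  enters: the image of the Laplacian is then as large as the zero sum permits.

  Reciprocity itself (\<open>reciprocal_cone\<close>) is proved for the slices of cones
  \<open>{a \<ge> 0. h a \<ge> 0 for finitely many linear forms h}\<close> at a given height, the height being a linear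
  form with positive coefficients. If each form has constant sign on the generators, the cone is an
  orthant, and reciprocity follows by induction on the dimension from a difference equation for
  quasipolynomials (\<open>reciprocal_orthant\<close>). In general the orthant is subdivided as in Elliott's
  algorithm: a pair of generators \<open>u\<close>, \<open>w\<close> at which some form has opposite signs is replaced by
  \<open>u\<close>, \<open>u + w\<close> on one side and by \<open>u + w\<close>, \<open>w\<close> on the other. All lattice points keep integer
  coefficients, so no lattice other than that of integer vectors is ever met. Reciprocity is additive
  under the subdivision (\<open>reciprocal_split\<close>), and the subdivision ends (\<open>reciprocal_resolve\<close>).
\<close>

section \<open>Quasipolynomials\<close>

text \<open>
  The closure properties below need a map that sends an integer to the representative of its
  residue class. With representatives in \<open>{0..<k}\<close> this map is \<open>mod\<close>.
\<close>

lemma quasipolynomial_iff_mod: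
  "quasipolynomial f \<longleftrightarrow>
     (\<exists>k>0. \<exists>p :: int \<Rightarrow> real poly. \<forall>m. f m = poly (p (m mod k)) (of_int m))"
proof
  assume "quasipolynomial f"
  then obtain k and p :: "nat \<Rightarrow> real poly" where k: "k > 0"
    and p: "\<And>j m. j \<in> {1..k} \<Longrightarrow> [m = int j] (mod int k) \<Longrightarrow> f m = poly (p j) (of_int m)"
    unfolding quasipolynomial_def by blast
  define r where "r x = (if x = 0 then k else nat x)" for x :: int
  have "f m = poly (p (r (m mod int k))) (of_int m)" for m
  proof (rule p)
    have "0 \<le> m mod int k" "m mod int k < int k" using k by auto
    then show "r (m mod int k) \<in> {1..k}"
      using k by (cases "m mod int k = 0")
        (auto simp: r_def nat_le_iff Suc_le_eq less_imp_le simp del: pos_mod_sign)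
    show "[m = int (r (m mod int k))] (mod int k)"
      using k by (auto simp: r_def cong_def)
  qed
  then show "\<exists>k>0. \<exists>p :: int \<Rightarrow> real poly. \<forall>m. f m = poly (p (m mod k)) (of_int m)"
    using k by (intro exI[of _ "int k"] conjI exI[of _ "\<lambda>x. p (r x)"]) auto
next
  assume "\<exists>k>0. \<exists>p :: int \<Rightarrow> real poly. \<forall>m. f m = poly (p (m mod k)) (of_int m)"
  then obtain k and p :: "int \<Rightarrow> real poly" where "k > 0"
    and "\<And>m. f m = poly (p (m mod k)) (of_int m)" by blast
  then show "quasipolynomial f"
    unfolding quasipolynomial_def
    by (intro exI[of _ "nat k"] conjI exI[of _ "\<lambda>j. p (int j mod k)"]) (auto simp: cong_def)
qed

lemma quasipolynomialI:
  assumes "k > 0" "\<And>m. f m = poly (p (m mod k)) (of_int m)"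
  shows "quasipolynomial f"
  using assms unfolding quasipolynomial_iff_mod by blast

lemma quasipolynomial_add:
  assumes "quasipolynomial f" "quasipolynomial g"
  shows "quasipolynomial (\<lambda>m. f m + g m)"
proof -
  obtain k and p :: "int \<Rightarrow> real poly" where p: "k > 0"
    "\<And>m. f m = poly (p (m mod k)) (of_int m)"
    using assms(1) unfolding quasipolynomial_iff_mod by blast
  obtain l and r :: "int \<Rightarrow> real poly" where r: "l > 0"
    "\<And>m. g m = poly (r (m mod l)) (of_int m)"
    using assms(2) unfolding quasipolynomial_iff_mod by blast
  show ?thesis
    by (rule quasipolynomialI[where k = "k * l" and p = "\<lambda>x. p (x mod k) + r (x mod l)"])
      (use p r in \<open>simp_all add: mod_mod_cancel\<close>)
qed

lemma quasipolynomial_periodic: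
  assumes "p > 0"
  shows "quasipolynomial (\<lambda>m. g (m mod p))"
  by (rule quasipolynomialI[where k = p and p = "\<lambda>x. [:g x:]"]) (use assms in auto)

lemma quasipolynomial_zero: "quasipolynomial (\<lambda>_. 0)"
  using quasipolynomial_periodic[of 1 "\<lambda>_. 0"] by simp

lemma quasipolynomial_sum:
  assumes "\<And>i. i \<in> A \<Longrightarrow> quasipolynomial (f i)"
  shows "quasipolynomial (\<lambda>m. \<Sum>i\<in>A. f i m)"
  using assms
  by (induction A rule: infinite_finite_induct)
    (auto intro: quasipolynomial_add quasipolynomial_zero)

lemma quasipolynomial_affine:
  assumes "quasipolynomial f"
  shows "quasipolynomial (\<lambda>m. f (a * m + b))"
proof -
  obtain k and p :: "int \<Rightarrow> real poly" where p: "k > 0"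
    "\<And>m. f m = poly (p (m mod k)) (of_int m)"
    using assms unfolding quasipolynomial_iff_mod by blast
  have "(a * m + b) mod k = (a * (m mod k) + b) mod k" for m
    by (metis mod_add_left_eq mod_mult_right_eq)
  then show ?thesis
    by (intro quasipolynomialI[where k = k and
          p = "\<lambda>x. pcompose (p ((a * x + b) mod k)) [:of_int b, of_int a:]"])
      (use p in \<open>simp_all add: poly_pcompose algebra_simps\<close>)
qed

text \<open>
  For a monomial, the binomial theorem expresses \<open>(x + K) ^ (n + 1) - x ^ (n + 1)\<close> as a nonzero
  multiple of \<open>x ^ n\<close> plus lower powers, which have antidifferences by induction.
\<close>

lemma poly_antidifference:
  fixes K :: real
  assumes "K \<noteq> 0"
  shows "\<exists>S. \<forall>x. poly S (x + K) - poly S x = poly P x"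
proof -
  have "\<exists>S. \<forall>x. poly S (x + K) - poly S x = x ^ n" for n
  proof (induction n rule: less_induct)
    case (less n)
    then have "\<forall>j. \<exists>S. j < n \<longrightarrow> (\<forall>x. poly S (x + K) - poly S x = x ^ j)" by blast
    then obtain S where S: "\<And>j x. j < n \<Longrightarrow> poly (S j) (x + K) - poly (S j) x = x ^ j"
      by metis
    define b where "b j = of_nat (Suc n choose j) * K ^ (Suc n - j)" for j
    have bn: "b n = real (Suc n) * K" by (simp add: b_def)
    define U where
      "U = smult (1 / b n) (monom 1 (Suc n) - (\<Sum>j<n. smult (b j) (S j)))"
    have "poly U (x + K) - poly U x = x ^ n" for x
    proof -
      have "(x + K) ^ Suc n = (\<Sum>j\<le>Suc n. b j * x ^ j)"
        unfolding binomial_ring b_def by (simp add: mult_ac)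
      also have "\<dots> = (\<Sum>j<n. b j * x ^ j) + b n * x ^ n + x ^ Suc n"
        by (simp add: b_def lessThan_Suc_atMost[symmetric])
      finally have e: "(x + K) ^ Suc n = (\<Sum>j<n. b j * x ^ j) + b n * x ^ n + x ^ Suc n" .
      have "(\<Sum>j<n. b j * poly (S j) (x + K)) - (\<Sum>j<n. b j * poly (S j) x)
          = (\<Sum>j<n. b j * x ^ j)"
        unfolding sum_subtractf[symmetric] right_diff_distrib[symmetric]
        by (intro sum.cong refl) (simp add: S)
      then have "b n * (poly U (x + K) - poly U x) = b n * x ^ n"
        using e bn assms by (simp add: U_def poly_monom poly_sum right_diff_distrib)
      then show ?thesis using bn assms by simp
    qed
    then show ?case by blast
  qed
  then obtain S where S: "\<And>n x. poly (S n) (x + K) - poly (S n) x = x ^ n" by metis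
  define T where "T = (\<Sum>i\<le>degree P. smult (coeff P i) (S i))"
  have "poly T (x + K) - poly T x = poly P x" for x
    unfolding T_def poly_sum poly_smult sum_subtractf[symmetric] right_diff_distrib[symmetric] S
    by (simp add: poly_altdef)
  then show ?thesis by blast
qed

text \<open>
  If \<open>U\<close> is an antidifference for the step \<open>k * p\<close>, where \<open>k\<close> is a period of \<open>q\<close>, then
  \<open>U (t) + U (t + p) + \<dots> + U (t + (k - 1) * p)\<close> is one for the step \<open>p\<close>: the sum telescopes.
  The long step keeps the residue modulo the period, so that \<open>U\<close> is obtained from
  antidifferences of polynomials.
\<close>

lemma quasipolynomial_antidifference:
  assumes "quasipolynomial q" and "p > 0"
  shows "\<exists>Q. quasipolynomial Q \<and> (\<forall>t. Q (t + p) - Q t = q t)"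
proof -
  obtain k and r :: "int \<Rightarrow> real poly" where r: "k > 0"
    "\<And>m. q m = poly (r (m mod k)) (of_int m)"
    using assms unfolding quasipolynomial_iff_mod by blast
  define K where "K = k * p"
  have "real_of_int K \<noteq> 0" using r assms by (simp add: K_def)
  then have "\<exists>S. \<forall>x. poly S (x + of_int K) - poly S x = poly (r j) x" for j
    by (rule poly_antidifference)
  then obtain S where S: "\<And>j x. poly (S j) (x + of_int K) - poly (S j) x = poly (r j) x"
    by metis
  define U where "U t = poly (S (t mod k)) (of_int t)" for t
  have U: "quasipolynomial U" by (rule quasipolynomialI[OF r(1)]) (simp add: U_def)
  have Uq: "U (t + K) - U t = q t" for t
    using S[of "t mod k" "of_int t"] by (simp add: U_def r(2) K_def)
  define Q where "Q t = (\<Sum>i<nat k. U (t + int i * p))" for t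
  have "quasipolynomial Q"
    unfolding Q_def using quasipolynomial_affine[OF U, of 1]
    by (intro quasipolynomial_sum) auto
  moreover have "Q (t + p) - Q t = q t" for t
  proof -
    have "Q (t + p) - Q t = (\<Sum>i<nat k. U (t + int (Suc i) * p) - U (t + int i * p))"
      by (simp add: Q_def sum_subtractf algebra_simps)
    also have "\<dots> = U (t + int (nat k) * p) - U t"
      by (subst sum_lessThan_telescope) simp
    finally show ?thesis using Uq[of t] r(1) by (simp add: K_def)
  qed
  ultimately show ?thesis by blast
qed

section \<open>Lattice points in cones\<close>

text \<open>
  A cone is described by the coefficients of its points with respect to generators indexed by
  \<open>I\<close>; generators themselves never appear. What remains of them is the values that linear forms
  take on them, and these values are the coefficients of a form in \<open>linform\<close>.
\<close>

definition linform :: "'i set \<Rightarrow> ('i \<Rightarrow> int) \<Rightarrow> ('i \<Rightarrow> nat) \<Rightarrow> int" where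
  "linform I h a = (\<Sum>i\<in>I. h i * int (a i))"

text \<open>
  The parameter \<open>s\<close> treats the closed cone (\<open>s = 0\<close>) and its interior (\<open>s = 1\<close>) together: all
  quantities are integers, so that positive means at least 1. The value 0 outside \<open>I\<close> makes the
  coefficients unique.
\<close>

definition cone :: "nat \<Rightarrow> 'i set \<Rightarrow> ('k \<Rightarrow> 'i \<Rightarrow> int) \<Rightarrow> 'k set \<Rightarrow> ('i \<Rightarrow> nat) set" where
  "cone s I H K =
     {a. (\<forall>i\<in>I. s \<le> a i) \<and> (\<forall>i. i \<notin> I \<longrightarrow> a i = 0) \<and> (\<forall>k\<in>K. int s \<le> linform I (H k) a)}"

definition slice ::
  "nat \<Rightarrow> 'i set \<Rightarrow> ('i \<Rightarrow> int) \<Rightarrow> ('k \<Rightarrow> 'i \<Rightarrow> int) \<Rightarrow> 'k set \<Rightarrow> int \<Rightarrow> ('i \<Rightarrow> nat) set" where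
  "slice s I \<tau> H K t = {a \<in> cone s I H K. linform I \<tau> a = t}"

text \<open>
  Ehrhart-Macdonald reciprocity for the slices of a cone at height \<open>t\<close>. A cone with interior points has
  slices of dimension \<open>card I - 1\<close>, which accounts for the minus sign. The case \<open>t = 0\<close> of the second law is
  included: the closed slice is then the origin alone if all heights are positive.
\<close>

definition reciprocal ::
  "'i set \<Rightarrow> ('i \<Rightarrow> int) \<Rightarrow> ('k \<Rightarrow> 'i \<Rightarrow> int) \<Rightarrow> 'k set \<Rightarrow> bool" where
  "reciprocal I \<tau> H K \<longleftrightarrow>
     (\<exists>q. quasipolynomial q \<and>
        (\<forall>t>0. q t = real (card (slice 1 I \<tau> H K t))) \<and>
        (\<forall>t\<ge>0. (-1) ^ card I * q (- t) = - real (card (slice 0 I \<tau> H K t))))"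

lemma linform_nonneg: "(\<And>i. i \<in> I \<Longrightarrow> 0 \<le> h i) \<Longrightarrow> 0 \<le> linform I h a"
  unfolding linform_def by (intro sum_nonneg) simp

lemma linform_pos:
  assumes "finite I" "\<And>i. i \<in> I \<Longrightarrow> 0 \<le> h i" "\<And>i. i \<in> I \<Longrightarrow> 0 < a i" "j \<in> I" "0 < h j"
  shows "0 < linform I h a"
  unfolding linform_def using assms by (intro sum_pos2[of I j]) auto

lemma linform_combination:
  "linform I h (\<lambda>i. x * a i + y * b i) = int x * linform I h a + int y * linform I h b"
  by (simp add: linform_def sum_distrib_left sum.distrib algebra_simps)

lemma finite_slice:
  assumes I: "finite I" and \<tau>: "\<And>i. i \<in> I \<Longrightarrow> 0 < \<tau> i"
  shows "finite (slice s I \<tau> H K t)"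
proof (rule finite_subset)
  show "finite {a. \<forall>i. (i \<in> I \<longrightarrow> a i \<in> {..nat t}) \<and> (i \<notin> I \<longrightarrow> a i = (0::nat))}"
    by (intro finite_set_of_finite_funs I) simp
  show "slice s I \<tau> H K t \<subseteq>
      {a. \<forall>i. (i \<in> I \<longrightarrow> a i \<in> {..nat t}) \<and> (i \<notin> I \<longrightarrow> a i = (0::nat))}"
  proof
    fix a assume a: "a \<in> slice s I \<tau> H K t"
    have "a i \<le> nat t" if i: "i \<in> I" for i
    proof -
      have "1 * int (a i) \<le> \<tau> i * int (a i)" using \<tau>[OF i] by (intro mult_right_mono) auto
      also have "\<dots> \<le> linform I \<tau> a"
        unfolding linform_def using i I \<tau> by (intro member_le_sum) (auto simp: order_less_imp_le)
      finally show ?thesis using a by (simp add: slice_def)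
    qed
    then show "a \<in> {a. \<forall>i. (i \<in> I \<longrightarrow> a i \<in> {..nat t}) \<and> (i \<notin> I \<longrightarrow> a i = 0)}"
      using a by (auto simp: slice_def cone_def)
  qed
qed

section \<open>Orthants\<close>

text \<open>
  The coefficient of \<open>j\<close> is either minimal, or it can be lowered by 1.
\<close>

lemma slice_orthant_card:
  assumes I: "finite I" and j: "j \<notin> I" and \<tau>: "\<And>i. i \<in> insert j I \<Longrightarrow> 0 < \<tau> i"
  shows "card (slice s (insert j I) \<tau> H {} t) =
    card (slice s I \<tau> H {} (t - int s * \<tau> j)) + card (slice s (insert j I) \<tau> H {} (t - \<tau> j))"
proof -
  let ?A = "slice s (insert j I) \<tau> H {}"
  have fin: "finite (?A t)" for t using I \<tau> by (intro finite_slice) auto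
  have form: "linform (insert j I) \<tau> a = \<tau> j * int (a j) + linform I \<tau> a" for a
    using I j by (simp add: linform_def)
  have upd: "linform I \<tau> (a(j := x)) = linform I \<tau> a" for a x
    unfolding linform_def using j by (intro sum.cong) auto
  have "bij_betw (\<lambda>a. a(j := 0)) {a \<in> ?A t. a j = s} (slice s I \<tau> H {} (t - int s * \<tau> j))"
    by (rule bij_betw_byWitness[where f' = "\<lambda>a. a(j := s)"])
      (use j in \<open>auto simp: slice_def cone_def form upd fun_eq_iff\<close>)
  then have 1: "card {a \<in> ?A t. a j = s} = card (slice s I \<tau> H {} (t - int s * \<tau> j))"
    by (rule bij_betw_same_card)
  have "bij_betw (\<lambda>a. a(j := a j - 1)) {a \<in> ?A t. s < a j} (?A (t - \<tau> j))"
    by (rule bij_betw_byWitness[where f' = "\<lambda>a. a(j := a j + 1)"])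
      (use j in \<open>auto simp: slice_def cone_def form upd fun_eq_iff algebra_simps of_nat_diff\<close>)
  then have 2: "card {a \<in> ?A t. s < a j} = card (?A (t - \<tau> j))"
    by (rule bij_betw_same_card)
  have "?A t = {a \<in> ?A t. a j = s} \<union> {a \<in> ?A t. s < a j}"
    by (auto simp: slice_def cone_def)
  then have "card (?A t) = card ({a \<in> ?A t. a j = s} \<union> {a \<in> ?A t. s < a j})" by simp
  also have "\<dots> = card {a \<in> ?A t. a j = s} + card {a \<in> ?A t. s < a j}"
    using fin by (intro card_Un_disjoint) auto
  finally show ?thesis using 1 2 by simp
qed

lemma slice_open_empty:
  assumes "finite I" "I \<noteq> {}" "\<And>i. i \<in> I \<Longrightarrow> 0 < \<tau> i" "t \<le> 0"
  shows "slice 1 I \<tau> H K t = {}"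
proof -
  obtain j where j: "j \<in> I" using assms by blast
  have "0 < linform I \<tau> a" if "\<And>i. i \<in> I \<Longrightarrow> 0 < a i" for a
  proof (rule linform_pos)
    show "0 \<le> \<tau> i" if "i \<in> I" for i using assms(3)[OF that] by simp
  qed (use assms that j in auto)
  then have "0 < t" if "a \<in> slice 1 I \<tau> H K t" for a
    using that by (auto simp: slice_def cone_def Suc_le_eq)
  then show ?thesis using assms(4) by (meson all_not_in_conv not_less)
qed

lemma slice_closed_empty:
  assumes "\<And>i. i \<in> I \<Longrightarrow> 0 < \<tau> i" "t < 0"
  shows "slice s I \<tau> H K t = {}"
proof -
  have "0 \<le> linform I \<tau> a" for a by (intro linform_nonneg less_imp_le assms(1))
  then show ?thesis using assms(2) by (auto simp: slice_def not_less[symmetric])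
qed

text \<open>
  By \<open>slice_orthant_card\<close>, both counting functions change by a count for \<open>I\<close> when the argument moves
  by the height of the new generator \<open>j\<close>. The two recurrences are the same difference equation, read
  at \<open>t\<close> and at \<open>- t\<close>, and an antidifference that vanishes on \<open>{1..\<tau> j}\<close> has the right initial
  values for both: the interior has no points at the heights \<open>{1..\<tau> j}\<close>, because \<open>j\<close> contributes at
  least \<open>\<tau> j\<close>, and \<open>I\<close>, which is not empty, contributes more.
\<close>

lemma reciprocal_orthant:
  assumes "finite I" "I \<noteq> {}" "\<And>i. i \<in> I \<Longrightarrow> 0 < \<tau> i"
  shows "reciprocal I \<tau> H {}"
  using assms
proof (induction I rule: finite_ne_induct)
  case (singleton j)
  define q :: "int \<Rightarrow> real" where "q t = (if t mod \<tau> j = 0 then 1 else 0)" for t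
  have \<tau>: "\<tau> j > 0" using singleton by simp
  have sl: "slice s {j} \<tau> H {} t = (if \<tau> j dvd t \<and> int s \<le> t div \<tau> j
      then {\<lambda>i. if i = j then nat (t div \<tau> j) else 0} else {})" for s t
    using \<tau> by (auto simp: slice_def cone_def linform_def fun_eq_iff nat_le_iff le_nat_iff)
  have "quasipolynomial q" unfolding q_def by (intro quasipolynomial_periodic \<tau>)
  moreover have "q t = card (slice 1 {j} \<tau> H {} t)" if "t > 0" for t
  proof -
    have "1 \<le> t div \<tau> j" if "\<tau> j dvd t"
      using that \<tau> \<open>t > 0\<close> by (simp add: pos_imp_zdiv_pos_iff zdvd_imp_le int_one_le_iff_zero_less)
    then show ?thesis by (simp add: q_def sl mod_eq_0_iff_dvd)
  qed
  moreover have "q (- t) = card (slice 0 {j} \<tau> H {} t)" if "t \<ge> 0" for t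
    using \<tau> that by (simp add: q_def sl mod_eq_0_iff_dvd pos_imp_zdiv_nonneg_iff)
  ultimately show ?case unfolding reciprocal_def by (intro exI[of _ q]) auto
next
  case (insert j I)
  define p where "p = \<tau> j"
  have p: "p > 0" using insert by (simp add: p_def)
  obtain q where q: "quasipolynomial q"
    and qpos: "\<And>t. t > 0 \<Longrightarrow> q t = real (card (slice 1 I \<tau> H {} t))"
    and qneg: "\<And>t. t \<ge> 0 \<Longrightarrow> (-1) ^ card I * q (- t) = - real (card (slice 0 I \<tau> H {} t))"
    using insert unfolding reciprocal_def by auto
  obtain Q' where Q': "quasipolynomial Q'" "\<And>t. Q' (t + p) - Q' t = q t"
    using quasipolynomial_antidifference[OF q p] by blast
  \<comment> \<open>A \<open>p\<close>-periodic correction makes the antidifference vanish on \<open>{1..p}\<close>.\<close>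
  define Q where "Q t = Q' t + - Q' ((t - 1) mod p + 1)" for t
  have "quasipolynomial (\<lambda>t. - Q' ((1 * t + - 1) mod p + 1))"
    by (intro quasipolynomial_affine[of "\<lambda>t. - Q' (t mod p + 1)"] quasipolynomial_periodic p)
  then have quasi: "quasipolynomial Q"
    unfolding Q_def using Q' by (intro quasipolynomial_add) auto
  have step: "Q (t + p) = Q t + q t" for t
  proof -
    have "(t + p - 1) mod p = (t - 1) mod p"
      using mod_add_self2[of "t - 1" p] by (simp add: algebra_simps)
    then show ?thesis using Q'(2)[of t] by (simp add: Q_def)
  qed
  have zero: "Q t = 0" if "0 < t" "t \<le> p" for t
    using that by (simp add: Q_def)
  let ?A = "\<lambda>s. slice s (insert j I) \<tau> H {}"
  note rec = slice_orthant_card[of I j \<tau> _ H, folded p_def]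
  have pos: "Q t = real (card (?A 1 t))" if "t > 0" for t
    using that
  proof (induction "nat t" arbitrary: t rule: less_induct)
    case less
    have r: "card (?A 1 t) = card (slice 1 I \<tau> H {} (t - p)) + card (?A 1 (t - p))"
      using rec[of 1 t] insert by simp
    show ?case
    proof (cases "t \<le> p")
      case True
      then show ?thesis
        using r zero[OF less(2)] insert slice_open_empty[of I \<tau> "t - p" H "{}"]
          slice_open_empty[of "insert j I" \<tau> "t - p" H "{}"] by simp
    next
      case False
      then show ?thesis
        using r step[of "t - p"] less(1)[of "t - p"] p qpos[of "t - p"] by simp
    qed
  qed
  have neg: "(-1) ^ card (insert j I) * Q (- t) = - real (card (?A 0 t))" if "t \<ge> 0" for t
    using that
  proof (induction "nat t" arbitrary: t rule: less_induct)
    case less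
    have r: "card (?A 0 t) = card (slice 0 I \<tau> H {} t) + card (?A 0 (t - p))"
      using rec[of 0 t] insert by simp
    have e: "(-1) ^ card (insert j I) * Q (- t) =
        (-1) ^ card (insert j I) * Q (- (t - p)) + (-1) ^ card I * q (- t)"
      using step[of "- t"] insert by (simp add: algebra_simps)
    show ?case
    proof (cases "t < p")
      case True
      then show ?thesis
        using r e zero[of "p - t"] less(2) insert qneg[of t]
          slice_closed_empty[of "insert j I" \<tau> "t - p" 0 H "{}"] by simp
    next
      case False
      then show ?thesis
        using r e less(1)[of "t - p"] p qneg[of t] by simp
    qed
  qed
  show ?case unfolding reciprocal_def using quasi pos neg by blast
qed

section \<open>Subdivision of a cone\<close>

text \<open>
  Replacing the generator \<open>w\<close> of a cone by \<open>u + w\<close> adds the value of a linear form at \<open>u\<close> to its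
  value at \<open>w\<close>.
\<close>

definition merge :: "'i \<Rightarrow> 'i \<Rightarrow> ('i \<Rightarrow> int) \<Rightarrow> 'i \<Rightarrow> int" where
  "merge u w h = h(w := h u + h w)"

lemma linform_merge:
  assumes "finite I" "u \<in> I" "w \<in> I" "u \<noteq> w"
  shows "linform I (merge u w h) a = linform I h (a(u := a u + a w))"
proof -
  have upd: "linform J g b = linform J g' b'"
    if "\<And>i. i \<in> J \<Longrightarrow> g i = g' i" "\<And>i. i \<in> J \<Longrightarrow> b i = b' i" for J g g' and b b' :: "'a \<Rightarrow> nat"
    unfolding linform_def using that by (intro sum.cong) auto
  have rem: "linform I g b = g u * int (b u) + (g w * int (b w) + linform (I - {u} - {w}) g b)"
    for g and b :: "'a \<Rightarrow> nat"
    unfolding linform_def using assms by (simp add: sum.remove[of I u] sum.remove[of "I - {u}" w])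
  have "linform (I - {u} - {w}) (merge u w h) a
      = linform (I - {u} - {w}) h (a(u := a u + a w))"
    by (rule upd) (auto simp: merge_def)
  then show ?thesis
    using assms unfolding rem[of "merge u w h" a] rem[of h "a(u := a u + a w)"]
    by (simp add: merge_def algebra_simps)
qed

lemma linform_merge_wall:
  assumes "finite I" "u \<in> I" "w \<in> I" "u \<noteq> w"
  shows "linform (I - {w}) (merge w u h) a = linform I h (a(w := a u))"
proof -
  have upd: "linform J g b = linform J g' b'"
    if "\<And>i. i \<in> J \<Longrightarrow> g i = g' i" "\<And>i. i \<in> J \<Longrightarrow> b i = b' i" for J g g' and b b' :: "'a \<Rightarrow> nat"
    unfolding linform_def using that by (intro sum.cong) auto
  have rem: "linform (I - {w}) g b = g u * int (b u) + linform (I - {w} - {u}) g b"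
    for g and b :: "'a \<Rightarrow> nat"
    unfolding linform_def using assms by (simp add: sum.remove[of "I - {w}" u])
  have rem': "linform I g b = g w * int (b w) + linform (I - {w}) g b" for g and b :: "'a \<Rightarrow> nat"
    unfolding linform_def using assms by (simp add: sum.remove[of I w])
  have "linform (I - {w} - {u}) (merge w u h) a = linform (I - {w} - {u}) h (a(w := a u))"
    by (rule upd) (auto simp: merge_def)
  then show ?thesis
    using assms unfolding rem'[of h] rem
    by (simp add: merge_def algebra_simps)
qed

text \<open>
  For \<open>a w \<le> a u\<close> the point with coefficients \<open>a u\<close>, \<open>a w\<close> at the generators \<open>u\<close>, \<open>w\<close> is also the point
  with coefficients \<open>a u - a w\<close>, \<open>a w\<close> at the generators \<open>u\<close>, \<open>u + w\<close>. The summand \<open>s\<close> keeps the new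
  coefficient positive in the interior.
\<close>

lemma cone_merge_bij:
  assumes "finite I" "u \<in> I" "w \<in> I" "u \<noteq> w"
  shows "bij_betw (\<lambda>b. b(u := b u + b w))
    (cone s I (\<lambda>k. merge u w (H k)) K) {a \<in> cone s I H K. a w + s \<le> a u}"
  using assms(2-)
  by (intro bij_betw_byWitness[where f' = "\<lambda>a. a(u := a u - a w)"])
    (force simp: cone_def linform_merge[OF assms])+

text \<open>
  On the wall between the two halves, \<open>u + w\<close> replaces both generators; its coefficient is stored at
  the index \<open>u\<close>.
\<close>

lemma cone_merge_wall_bij:
  assumes "finite I" "u \<in> I" "w \<in> I" "u \<noteq> w"
  shows "bij_betw (\<lambda>b. b(w := b u))
    (cone s (I - {w}) (\<lambda>k. merge w u (H k)) K) {a \<in> cone s I H K. a u = a w}"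
proof -
  have e: "linform (I - {w}) (merge w u h) (a(w := x)) = linform I h (a(w := a u))" for h a x
    using assms by (simp add: linform_merge_wall)
  show ?thesis
    using assms(2-)
    by (intro bij_betw_byWitness[where f' = "\<lambda>a. a(w := 0)"])
      (auto simp: cone_def e linform_merge_wall[OF assms] fun_upd_idem split: if_splits)
qed

lemma slice_merge_card:
  assumes "finite I" "u \<in> I" "w \<in> I" "u \<noteq> w"
  shows "card (slice s I (merge u w \<tau>) (\<lambda>k. merge u w (H k)) K t)
    = card {a \<in> slice s I \<tau> H K t. a w + s \<le> a u}"
proof (rule bij_betw_same_card)
  let ?f = "\<lambda>b. b(u := b u + b w)"
  have "bij_betw ?f (slice s I (merge u w \<tau>) (\<lambda>k. merge u w (H k)) K t)
      (?f ` slice s I (merge u w \<tau>) (\<lambda>k. merge u w (H k)) K t)"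
    by (rule bij_betw_subset[OF cone_merge_bij[OF assms]]) (auto simp: slice_def)
  moreover have "?f ` slice s I (merge u w \<tau>) (\<lambda>k. merge u w (H k)) K t
      = {a \<in> slice s I \<tau> H K t. a w + s \<le> a u}"
  proof -
    have "?f ` slice s I (merge u w \<tau>) (\<lambda>k. merge u w (H k)) K t
        = {a \<in> ?f ` cone s I (\<lambda>k. merge u w (H k)) K. linform I \<tau> a = t}"
      by (auto simp: slice_def linform_merge[OF assms])
    also have "?f ` cone s I (\<lambda>k. merge u w (H k)) K = {a \<in> cone s I H K. a w + s \<le> a u}"
      using cone_merge_bij[OF assms, of s H K] by (simp add: bij_betw_def)
    also have "{a \<in> {a \<in> cone s I H K. a w + s \<le> a u}. linform I \<tau> a = t}
        = {a \<in> slice s I \<tau> H K t. a w + s \<le> a u}"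
      by (auto simp: slice_def)
    finally show ?thesis .
  qed
  ultimately show "bij_betw ?f (slice s I (merge u w \<tau>) (\<lambda>k. merge u w (H k)) K t)
    {a \<in> slice s I \<tau> H K t. a w + s \<le> a u}" by simp
qed

lemma slice_merge_wall_card:
  assumes "finite I" "u \<in> I" "w \<in> I" "u \<noteq> w"
  shows "card (slice s (I - {w}) (merge w u \<tau>) (\<lambda>k. merge w u (H k)) K t)
    = card {a \<in> slice s I \<tau> H K t. a u = a w}"
proof (rule bij_betw_same_card)
  let ?f = "\<lambda>b. b(w := b u)"
  let ?S = "slice s (I - {w}) (merge w u \<tau>) (\<lambda>k. merge w u (H k)) K t"
  have "bij_betw ?f ?S (?f ` ?S)"
    by (rule bij_betw_subset[OF cone_merge_wall_bij[OF assms]]) (auto simp: slice_def)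
  moreover have "?f ` ?S = {a \<in> slice s I \<tau> H K t. a u = a w}"
  proof -
    have "?f ` ?S
        = {a \<in> ?f ` cone s (I - {w}) (\<lambda>k. merge w u (H k)) K. linform I \<tau> a = t}"
      by (auto simp: slice_def linform_merge_wall[OF assms])
    also have "?f ` cone s (I - {w}) (\<lambda>k. merge w u (H k)) K = {a \<in> cone s I H K. a u = a w}"
      using cone_merge_wall_bij[OF assms, of s H K] by (simp add: bij_betw_def)
    also have "{a \<in> {a \<in> cone s I H K. a u = a w}. linform I \<tau> a = t}
        = {a \<in> slice s I \<tau> H K t. a u = a w}"
      by (auto simp: slice_def)
    finally show ?thesis .
  qed
  ultimately show "bij_betw ?f ?S {a \<in> slice s I \<tau> H K t. a u = a w}" by simp
qed

text \<open>
  Convexity: some combination of \<open>x\<close> and \<open>y\<close> with nonnegative integer weights lies on the wall. It is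
  an interior point, because \<open>y\<close> is one and has a positive weight.
\<close>

lemma cone_crosses_wall:
  assumes x: "x \<in> cone 0 I H K" "x u < x w"
    and y: "y \<in> cone 1 I H K" "y w \<le> y u"
  shows "\<exists>z \<in> cone 1 I H K. z u = z w"
proof (cases "y w = y u")
  case False
  define m where "m = y u - y w"
  define n where "n = x w - x u"
  define z where "z = (\<lambda>i. m * x i + n * y i)"
  have pos: "m > 0" "n > 0" using False x y by (auto simp: m_def n_def)
  have "1 \<le> z i" if "i \<in> I" for i
    using that pos y by (auto simp: z_def cone_def Suc_le_eq)
  moreover have "1 \<le> linform I (H k) z" if "k \<in> K" for k
  proof -
    have "0 \<le> linform I (H k) x" "1 \<le> linform I (H k) y"
      using x y that by (auto simp: cone_def)
    then have "0 \<le> int m * linform I (H k) x" "1 * 1 \<le> int n * linform I (H k) y"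
      using pos by (auto intro!: mult_mono simp del: mult_1 mult_1_right)
    then show ?thesis unfolding z_def linform_combination by simp
  qed
  ultimately have "z \<in> cone 1 I H K" using x y by (auto simp: cone_def z_def)
  moreover have "int (z u) = int (z w)"
    using x y by (simp add: z_def m_def n_def of_nat_diff algebra_simps)
  ultimately show ?thesis by auto
next
  case True
  then show ?thesis using y by metis
qed

text \<open>
  A large multiple of an interior point remains interior when a generator is added.
\<close>

lemma cone_open_perturb:
  assumes I: "finite I" "u \<in> I" and K: "finite K" and z: "z \<in> cone 1 I H K"
  shows "\<exists>N. (\<lambda>i. N * z i + (if i = u then 1 else 0)) \<in> cone 1 I H K"
proof -
  define N where "N = nat (1 + (\<Sum>k\<in>K. \<bar>H k u\<bar>))"
  have N: "int N = 1 + (\<Sum>k\<in>K. \<bar>H k u\<bar>)" by (simp add: N_def sum_nonneg)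
  then have N1: "1 \<le> N" using sum_nonneg[of K "\<lambda>k. \<bar>H k u\<bar>"] by linarith
  let ?z = "\<lambda>i. N * z i + (if i = u then 1 else 0)"
  have "1 \<le> linform I (H k) ?z" if k: "k \<in> K" for k
  proof -
    have "linform I (H k) ?z = linform I (H k) (\<lambda>i. N * z i + 1 * (if i = u then 1 else 0))"
      by simp
    also have "\<dots> = int N * linform I (H k) z + H k u"
      unfolding linform_combination using I by (simp add: linform_def if_distrib sum.delta cong: if_cong)
    finally have e: "linform I (H k) ?z = int N * linform I (H k) z + H k u" .
    have "\<bar>H k u\<bar> \<le> (\<Sum>k\<in>K. \<bar>H k u\<bar>)" using k K by (intro member_le_sum) auto
    moreover have "int N * 1 \<le> int N * linform I (H k) z"
      using z k by (intro mult_left_mono) (auto simp: cone_def)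
    ultimately show ?thesis using e N by linarith
  qed
  moreover have "1 \<le> ?z i" if "i \<in> I" for i using that z N1 by (auto simp: cone_def Suc_le_eq)
  ultimately show ?thesis using z I by (intro exI[of _ N]) (auto simp: cone_def)
qed

text \<open>
  The wall \<open>a u = a w\<close> splits the interior into three disjoint parts, whose counts add up. The two
  closed halves cover the closed cone and share the closed wall, which is counted negatively; as the
  wall has one dimension less, this is the sign with which its reciprocity enters. If the wall has no
  interior points, then by convexity all interior points lie on one side, and the other closed half
  is part of the wall, so that the cone may be replaced by one half.
\<close>

lemma reciprocal_split:
  fixes K :: "'k set"
  assumes I: "finite I" "u \<in> I" "w \<in> I" "u \<noteq> w" and K: "finite K"
    and \<tau>: "\<And>i. i \<in> I \<Longrightarrow> 0 < \<tau> i" and ne: "cone 1 I H K \<noteq> {}"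
    and r1: "cone 1 I (\<lambda>k. merge u w (H k)) K \<noteq> {} \<Longrightarrow>
      reciprocal I (merge u w \<tau>) (\<lambda>k. merge u w (H k)) K"
    and r2: "cone 1 I (\<lambda>k. merge w u (H k)) K \<noteq> {} \<Longrightarrow>
      reciprocal I (merge w u \<tau>) (\<lambda>k. merge w u (H k)) K"
    and r0: "cone 1 (I - {w}) (\<lambda>k. merge w u (H k)) K \<noteq> {} \<Longrightarrow>
      reciprocal (I - {w}) (merge w u \<tau>) (\<lambda>k. merge w u (H k)) K"
  shows "reciprocal I \<tau> H K"
proof -
  define S where "S s t = slice s I \<tau> H K t" for s t
  define C1 where "C1 = {a \<in> cone 1 I H K. a w < a u}"
  define C2 where "C2 = {a \<in> cone 1 I H K. a u < a w}"
  define C0 where "C0 = {a \<in> cone 1 I H K. a u = a w}"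
  have fin: "finite (S s t)" for s t unfolding S_def using I \<tau> by (intro finite_slice) auto
  have wu: "w \<noteq> u" using I by simp
  have ne1: "cone 1 I (\<lambda>k. merge u w (H k)) K \<noteq> {} \<longleftrightarrow> C1 \<noteq> {}"
    using cone_merge_bij[OF I, of 1 H K] by (auto simp: bij_betw_def C1_def Suc_le_eq)
  have ne2: "cone 1 I (\<lambda>k. merge w u (H k)) K \<noteq> {} \<longleftrightarrow> C2 \<noteq> {}"
    using cone_merge_bij[OF I(1,3,2) wu, of 1 H K] by (auto simp: bij_betw_def C2_def Suc_le_eq)
  have ne0: "cone 1 (I - {w}) (\<lambda>k. merge w u (H k)) K \<noteq> {} \<longleftrightarrow> C0 \<noteq> {}"
    using cone_merge_wall_bij[OF I, of 1 H K] by (auto simp: bij_betw_def C0_def)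
  have rec1: "\<exists>q. quasipolynomial q \<and> (\<forall>t>0. q t = real (card {a \<in> S 1 t. a w < a u})) \<and>
      (\<forall>t\<ge>0. (-1) ^ card I * q (- t) = - real (card {a \<in> S 0 t. a w \<le> a u}))" if "C1 \<noteq> {}"
    using r1 that ne1 unfolding reciprocal_def slice_merge_card[OF I] S_def by (simp add: Suc_le_eq)
  have rec2: "\<exists>q. quasipolynomial q \<and> (\<forall>t>0. q t = real (card {a \<in> S 1 t. a u < a w})) \<and>
      (\<forall>t\<ge>0. (-1) ^ card I * q (- t) = - real (card {a \<in> S 0 t. a u \<le> a w}))" if "C2 \<noteq> {}"
    using r2 that ne2 unfolding reciprocal_def slice_merge_card[OF I(1,3,2) wu] S_def
    by (simp add: Suc_le_eq)
  have sgn: "(-1) ^ card (I - {w}) = - ((-1) ^ card I :: real)"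
    using I by (simp add: card_Diff_singleton power_eq_if[of _ "card I"] card_gt_0_iff)
      (auto simp: card_eq_0_iff)
  have rec0: "\<exists>q. quasipolynomial q \<and> (\<forall>t>0. q t = real (card {a \<in> S 1 t. a u = a w})) \<and>
      (\<forall>t\<ge>0. (-1) ^ card I * q (- t) = real (card {a \<in> S 0 t. a u = a w}))" if "C0 \<noteq> {}"
    using r0 that ne0 unfolding reciprocal_def slice_merge_wall_card[OF I] S_def sgn by simp
  \<comment> \<open>A wall that meets the interior has interior points on both sides.\<close>
  have both: "C1 \<noteq> {} \<and> C2 \<noteq> {}" if "C0 \<noteq> {}"
  proof -
    obtain z where z: "z \<in> cone 1 I H K" "z u = z w" using \<open>C0 \<noteq> {}\<close> unfolding C0_def by blast
    obtain M where M: "(\<lambda>i. M * z i + (if i = u then 1 else 0)) \<in> cone 1 I H K"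
      using cone_open_perturb[OF I(1,2) K z(1)] by blast
    obtain N where N: "(\<lambda>i. N * z i + (if i = w then 1 else 0)) \<in> cone 1 I H K"
      using cone_open_perturb[OF I(1,3) K z(1)] by blast
    have "(\<lambda>i. M * z i + (if i = u then 1 else 0)) \<in> C1"
      using M z I by (simp add: C1_def)
    moreover have "(\<lambda>i. N * z i + (if i = w then 1 else 0)) \<in> C2"
      using N z I by (simp add: C2_def)
    ultimately show ?thesis by blast
  qed
  have cone_S: "a \<in> cone s I H K" if "a \<in> S s t" for a s t
    using that by (simp add: S_def slice_def)
  have card_open: "card (S 1 t) =
      card {a \<in> S 1 t. a w < a u} + card {a \<in> S 1 t. a u < a w} + card {a \<in> S 1 t. a u = a w}" for t
  proof -
    have "S 1 t = {a \<in> S 1 t. a w < a u} \<union> {a \<in> S 1 t. a u < a w} \<union> {a \<in> S 1 t. a u = a w}"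
      by auto
    then have "card (S 1 t) = card ({a \<in> S 1 t. a w < a u} \<union> {a \<in> S 1 t. a u < a w}
        \<union> {a \<in> S 1 t. a u = a w})" by simp
    also have "\<dots> = card ({a \<in> S 1 t. a w < a u} \<union> {a \<in> S 1 t. a u < a w})
        + card {a \<in> S 1 t. a u = a w}"
      using fin by (intro card_Un_disjoint) auto
    also have "card ({a \<in> S 1 t. a w < a u} \<union> {a \<in> S 1 t. a u < a w})
        = card {a \<in> S 1 t. a w < a u} + card {a \<in> S 1 t. a u < a w}"
      using fin by (intro card_Un_disjoint) auto
    finally show ?thesis .
  qed
  have card_closed: "card (S 0 t) + card {a \<in> S 0 t. a u = a w} =
      card {a \<in> S 0 t. a w \<le> a u} + card {a \<in> S 0 t. a u \<le> a w}" for t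
  proof -
    have "card {a \<in> S 0 t. a w \<le> a u} + card {a \<in> S 0 t. a u \<le> a w} =
        card ({a \<in> S 0 t. a w \<le> a u} \<union> {a \<in> S 0 t. a u \<le> a w})
        + card ({a \<in> S 0 t. a w \<le> a u} \<inter> {a \<in> S 0 t. a u \<le> a w})"
      using fin by (intro card_Un_Int) auto
    moreover have "{a \<in> S 0 t. a w \<le> a u} \<union> {a \<in> S 0 t. a u \<le> a w} = S 0 t" by auto
    moreover have "{a \<in> S 0 t. a w \<le> a u} \<inter> {a \<in> S 0 t. a u \<le> a w} = {a \<in> S 0 t. a u = a w}"
      by auto
    ultimately show ?thesis by simp
  qed
  show ?thesis
  proof (cases "C0 = {}")
    case False
    obtain q1 where q1: "quasipolynomial q1"
      "\<And>t. t > 0 \<Longrightarrow> q1 t = real (card {a \<in> S 1 t. a w < a u})"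
      "\<And>t. t \<ge> 0 \<Longrightarrow> (-1) ^ card I * q1 (- t) = - real (card {a \<in> S 0 t. a w \<le> a u})"
      using rec1 both False by blast
    obtain q2 where q2: "quasipolynomial q2"
      "\<And>t. t > 0 \<Longrightarrow> q2 t = real (card {a \<in> S 1 t. a u < a w})"
      "\<And>t. t \<ge> 0 \<Longrightarrow> (-1) ^ card I * q2 (- t) = - real (card {a \<in> S 0 t. a u \<le> a w})"
      using rec2 both False by blast
    obtain q0 where q0: "quasipolynomial q0"
      "\<And>t. t > 0 \<Longrightarrow> q0 t = real (card {a \<in> S 1 t. a u = a w})"
      "\<And>t. t \<ge> 0 \<Longrightarrow> (-1) ^ card I * q0 (- t) = real (card {a \<in> S 0 t. a u = a w})"
      using rec0 False by blast
    have "quasipolynomial (\<lambda>t. q1 t + q2 t + q0 t)"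
      by (intro quasipolynomial_add q0 q1 q2)
    moreover have "(-1) ^ card I * (q1 (- t) + q2 (- t) + q0 (- t)) = - real (card (S 0 t))"
      if "t \<ge> 0" for t
      unfolding distrib_left q0(3)[OF that] q1(3)[OF that] q2(3)[OF that]
      using card_closed[of t] by simp
    moreover have "q1 t + q2 t + q0 t = real (card (S 1 t))" if "t > 0" for t
      unfolding q0(2)[OF that] q1(2)[OF that] q2(2)[OF that] card_open[of t] by simp
    ultimately show ?thesis
      unfolding reciprocal_def S_def by blast
  next
    case True
    then have wall1: "\<not> (a u = a w)" if "a \<in> S 1 t" for a t
      using cone_S[OF that] by (auto simp: C0_def)
    consider "C1 \<noteq> {}" | "C2 \<noteq> {}"
      using ne True by (fastforce simp: C0_def C1_def C2_def)
    then show ?thesis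
    proof cases
      case 1
      then obtain y where y: "y \<in> cone 1 I H K" "y w \<le> y u" by (auto simp: C1_def)
      have side: "x w \<le> x u" if "x \<in> cone 0 I H K" for x
      proof (rule ccontr)
        assume "\<not> ?thesis"
        then have "x u < x w" by simp
        from cone_crosses_wall[OF that this y] True show False
          unfolding C0_def by (metis (mono_tags, lifting) empty_Collect_eq)
      qed
      have "cone 1 I H K \<subseteq> cone 0 I H K" by (force simp: cone_def)
      then have "{a \<in> S 1 t. a w < a u} = S 1 t" for t
        using wall1 side cone_S by (auto simp: less_le) (metis subsetD)+
      moreover have "{a \<in> S 0 t. a w \<le> a u} = S 0 t" for t using side cone_S by blast
      ultimately show ?thesis using rec1[OF 1] unfolding reciprocal_def S_def[symmetric] by simp
    next
      case 2
      then obtain y where y: "y \<in> cone 1 I H K" "y u \<le> y w" by (auto simp: C2_def)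
      have side: "x u \<le> x w" if "x \<in> cone 0 I H K" for x
      proof (rule ccontr)
        assume "\<not> ?thesis"
        then have "x w < x u" by simp
        from cone_crosses_wall[OF that this y] True show False
          unfolding C0_def by (metis (mono_tags, lifting) empty_Collect_eq)
      qed
      have "cone 1 I H K \<subseteq> cone 0 I H K" by (force simp: cone_def)
      then have "{a \<in> S 1 t. a u < a w} = S 1 t" for t
        using wall1 side cone_S by (auto simp: less_le) (metis subsetD)+
      moreover have "{a \<in> S 0 t. a u \<le> a w} = S 0 t" for t using side cone_S by blast
      ultimately show ?thesis using rec2[OF 2] unfolding reciprocal_def S_def[symmetric] by simp
    qed
  qed
qed

section \<open>Reciprocity for cones\<close>

definition mixed :: "'i set \<Rightarrow> ('i \<Rightarrow> int) \<Rightarrow> bool" where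
  "mixed I h \<longleftrightarrow> (\<exists>u\<in>I. 0 < h u) \<and> (\<exists>w\<in>I. h w < 0)"

lemma not_mixed_merge:
  assumes "\<not> mixed I h" "u \<in> I" "w \<in> I" "J \<subseteq> I"
  shows "\<not> mixed J (merge u w h)"
  using assms unfolding mixed_def merge_def
  by (smt (verit, ccfv_threshold) fun_upd_apply subset_iff)

text \<open>
  If the interior has a point, each form is positive at some generator, and hence nonnegative at all
  of them. The conditions in \<open>K\<close> then hold everywhere: the cone is a full orthant.
\<close>

lemma reciprocal_unmixed:
  assumes I: "finite I" "I \<noteq> {}" and \<tau>: "\<And>i. i \<in> I \<Longrightarrow> 0 < \<tau> i"
    and ne: "cone 1 I H K \<noteq> {}" and K: "\<And>k. k \<in> K \<Longrightarrow> \<not> mixed I (H k)"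
  shows "reciprocal I \<tau> H K"
proof -
  obtain a where a: "a \<in> cone 1 I H K" using ne by blast
  have sign: "(\<exists>u\<in>I. 0 < H k u) \<and> (\<forall>i\<in>I. 0 \<le> H k i)" if k: "k \<in> K" for k
  proof -
    have "0 < linform I (H k) a" using a k by (auto simp: cone_def)
    moreover have "linform I (H k) a \<le> 0" if "\<And>i. i \<in> I \<Longrightarrow> H k i \<le> 0"
      unfolding linform_def using that by (intro sum_nonpos) (simp add: mult_nonpos_nonneg)
    ultimately have "\<exists>u\<in>I. 0 < H k u" by (meson not_le)
    then show ?thesis using K[OF k] by (auto simp: mixed_def not_less[symmetric])
  qed
  have "cone 0 I H K = cone 0 I H {}"
    using sign by (auto simp: cone_def intro!: linform_nonneg)
  then have closed: "slice 0 I \<tau> H K t = slice 0 I \<tau> H {} t" for t by (simp add: slice_def)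
  have "cone 1 I H K = cone 1 I H {}"
  proof -
    have "1 \<le> linform I (H k) b" if k: "k \<in> K" and b: "\<And>i. i \<in> I \<Longrightarrow> 0 < b i" for k b
    proof -
      obtain u where u: "u \<in> I" "0 < H k u" using sign[OF k] by blast
      have "0 < linform I (H k) b"
        using sign[OF k] b I u by (intro linform_pos[of I "H k" b u]) auto
      then show ?thesis by simp
    qed
    then show ?thesis by (auto simp: cone_def Suc_le_eq)
  qed
  then have "slice 1 I \<tau> H K t = slice 1 I \<tau> H {} t" for t by (simp add: slice_def)
  then show ?thesis
    using reciprocal_orthant[OF I \<tau>, where H = H] closed unfolding reciprocal_def by simp
qed

text \<open>
  Elliott's reduction resolves one form \<open>l\<close>, whose values at the generators lie in \<open>{- b..a}\<close>. If one
  end of this interval is not attained, the interval can be shrunk. Otherwise the cone is split at a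
  generator \<open>u\<close> with value \<open>a\<close> and a generator \<open>w\<close> with value \<open>- b\<close>. In each part the value \<open>a - b\<close>,
  which lies strictly between the ends, replaces one of these two values, so that fewer generators
  have values at the ends. Forms that are
  already resolved stay so, since the new generator is a sum of old ones.
\<close>

lemma reciprocal_resolve:
  fixes K :: "'k set" and a b :: nat
  assumes K: "finite K"
    and resolved: "\<And>I :: 'i set. \<And>\<tau> H. finite I \<Longrightarrow> I \<noteq> {} \<Longrightarrow> (\<And>i. i \<in> I \<Longrightarrow> 0 < \<tau> i) \<Longrightarrow>
      cone 1 I H K \<noteq> {} \<Longrightarrow> {k \<in> K. mixed I (H k)} \<subseteq> X \<Longrightarrow> reciprocal I \<tau> H K"
    and "finite I" "I \<noteq> {}" "\<And>i. i \<in> I \<Longrightarrow> 0 < \<tau> i" "cone 1 I H K \<noteq> {}"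
    and "{k \<in> K. mixed I (H k)} \<subseteq> insert l X"
    and "\<And>i. i \<in> I \<Longrightarrow> - int b \<le> H l i \<and> H l i \<le> int a"
  shows "reciprocal I (\<tau> :: 'i \<Rightarrow> int) H K"
  using assms(3-)
proof (induction "(a + b, card {i \<in> I. H l i = int a \<or> H l i = - int b})"
    arbitrary: a b I \<tau> H rule: wf_induct_rule[OF wf_lex_prod[OF wf_less_than wf_less_than]])
  case (1 a b I H \<tau>)
  let ?ext = "\<lambda>I h. {i \<in> I. h i = int a \<or> h i = - int b}"
  note I = 1(2,3) and \<tau> = 1(4) and ne = 1(5) and X = 1(6) and bounds = 1(7)
  show ?case
  proof (cases "mixed I (H l)")
    case False
    then show ?thesis using X by (intro resolved I \<tau> ne) auto
  next
    case True
    then have ab: "0 < a" "0 < b" using bounds by (force simp: mixed_def)+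
    consider "\<forall>i\<in>I. H l i \<noteq> int a" | "\<forall>i\<in>I. H l i \<noteq> - int b"
      | u w where "u \<in> I" "H l u = int a" "w \<in> I" "H l w = - int b" by blast
    then show ?thesis
    proof cases
      case 1
      then have "- int b \<le> H l i \<and> H l i \<le> int (a - 1)" if "i \<in> I" for i
        using bounds[OF that] that ab by (force simp: of_nat_diff)
      then show ?thesis using ab by (intro "1.hyps"[OF _ I \<tau> ne X, of "a - 1" b]) auto
    next
      case 2
      then have "- int (b - 1) \<le> H l i \<and> H l i \<le> int a" if "i \<in> I" for i
        using bounds[OF that] that ab by (force simp: of_nat_diff)
      then show ?thesis using ab by (intro "1.hyps"[OF _ I \<tau> ne X, of a "b - 1"]) auto
    next
      case (3 u w)
      then have uw: "u \<noteq> w" using ab by auto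
      have less: "card (?ext J (merge x y (H l))) < card (?ext I (H l))"
        if "(x = u \<and> y = w) \<or> (x = w \<and> y = u)" "J \<subseteq> I" for x y J
      proof (rule psubset_card_mono)
        show "finite (?ext I (H l))" using I by simp
        have "?ext J (merge x y (H l)) \<subseteq> ?ext I (H l) - {y}"
          using that 3 ab by (auto simp: merge_def split: if_splits)
        moreover have "y \<in> ?ext I (H l)" using that 3 by auto
        ultimately show "?ext J (merge x y (H l)) \<subset> ?ext I (H l)" by blast
      qed
      have merged: "reciprocal J (merge x y \<tau>) (\<lambda>k. merge x y (H k)) K"
        if xy: "(x = u \<and> y = w) \<or> (x = w \<and> y = u)" and J: "J \<subseteq> I" "J \<noteq> {}"
          and c: "cone 1 J (\<lambda>k. merge x y (H k)) K \<noteq> {}" for x y J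
      proof (rule "1.hyps"[OF _ _ J(2) _ c])
        have mem: "x \<in> I" "y \<in> I" using xy 3 by auto
        show "((a + b, card (?ext J (merge x y (H l)))), a + b, card (?ext I (H l)))
            \<in> less_than <*lex*> less_than"
          using less[OF xy J(1)] by simp
        show "finite J" using J I finite_subset by blast
        show "0 < merge x y \<tau> i" if "i \<in> J" for i
          using \<tau> mem J that by (auto simp: merge_def intro: add_pos_pos)
        show "{k \<in> K. mixed J (merge x y (H k))} \<subseteq> insert l X"
          using X not_mixed_merge[OF _ mem J(1)] by blast
        show "- int b \<le> merge x y (H l) i \<and> merge x y (H l) i \<le> int a" if "i \<in> J" for i
          using bounds[of i] that J xy 3 by (auto simp: merge_def)
      qed
      show ?thesis
        by (rule reciprocal_split[OF I(1) 3(1,3) uw K \<tau> ne]; (rule merged)?)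
          (use I 3 uw in auto)
    qed
  qed
qed

text \<open>
  The forms are resolved one after the other. An empty interior has to be excluded: the closed cone
  contains the origin in any case.
\<close>

theorem reciprocal_cone:
  assumes "finite I" "I \<noteq> {}" "\<And>i. i \<in> I \<Longrightarrow> 0 < \<tau> i" "finite K" "cone 1 I H K \<noteq> {}"
  shows "reciprocal I \<tau> H K"
proof -
  have "reciprocal I \<tau> H K"
    if "finite X" "finite I" "I \<noteq> {}" "\<And>i. i \<in> I \<Longrightarrow> 0 < \<tau> i" "cone 1 I H K \<noteq> {}"
      "{k \<in> K. mixed I (H k)} \<subseteq> X" for X I \<tau> H
    using that
  proof (induction X arbitrary: I \<tau> H rule: finite_induct)
    case empty
    then show ?case by (intro reciprocal_unmixed) auto
  next
    case (insert l X)
    define m where "m = nat (\<Sum>i\<in>I. \<bar>H l i\<bar>)"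
    have m: "- int m \<le> H l i \<and> H l i \<le> int m" if "i \<in> I" for i
    proof -
      have "\<bar>H l i\<bar> \<le> (\<Sum>i\<in>I. \<bar>H l i\<bar>)" using that insert(4) by (intro member_le_sum) auto
      then show ?thesis by (auto simp: m_def)
    qed
    show ?case
      by (rule reciprocal_resolve[where X = X and l = l and a = m and b = m, OF assms(4)])
        (use insert m in blast)+
  qed
  from this[of "{k \<in> K. mixed I (H k)}"] show ?thesis using assms by auto
qed

section \<open>Laplacians with prescribed signs\<close>

text \<open>
  Gaussian elimination without division: the unknown \<open>k\<close> is eliminated with an equation in which it
  occurs.
\<close>

lemma homogeneous_system_nontrivial:
  fixes A :: "'j \<Rightarrow> 'i \<Rightarrow> int"
  assumes "finite J" "finite I" "card J < card I"
  shows "\<exists>x. (\<exists>i\<in>I. x i \<noteq> 0) \<and> (\<forall>j\<in>J. (\<Sum>i\<in>I. A j i * x i) = 0)"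
  using assms
proof (induction J arbitrary: I A rule: finite_induct)
  case empty
  then have "I \<noteq> {}" by auto
  then show ?case by (intro exI[of _ "\<lambda>_. 1"]) auto
next
  case (insert j J)
  show ?case
  proof (cases "\<forall>i\<in>I. A j i = 0")
    case True
    then show ?thesis using insert.IH[of I A] insert.prems insert.hyps by auto
  next
    case False
    then obtain k where k: "k \<in> I" "A j k \<noteq> 0" by blast
    define B where "B l i = A j k * A l i - A l k * A j i" for l i
    have "card J < card (I - {k})" using insert k by simp
    then obtain x where x: "\<exists>i\<in>I - {k}. x i \<noteq> 0" "\<And>l. l \<in> J \<Longrightarrow> (\<Sum>i\<in>I - {k}. B l i * x i) = 0"
      using insert.IH[of "I - {k}" B] insert.prems by blast
    define s where "s = (\<Sum>i\<in>I - {k}. A j i * x i)"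
    define y where "y i = (if i = k then - s else A j k * x i)" for i
    have y: "(\<Sum>i\<in>I. A l i * y i) = A j k * (\<Sum>i\<in>I - {k}. A l i * x i) - A l k * s" for l
    proof -
      have "(\<Sum>i\<in>I. A l i * y i) = - A l k * s + (\<Sum>i\<in>I - {k}. A l i * y i)"
        using insert.prems k by (simp add: sum.remove[of I k] y_def)
      also have "(\<Sum>i\<in>I - {k}. A l i * y i) = A j k * (\<Sum>i\<in>I - {k}. A l i * x i)"
        unfolding sum_distrib_left by (intro sum.cong) (auto simp: y_def)
      finally show ?thesis by simp
    qed
    have "(\<Sum>i\<in>I. A l i * y i) = (\<Sum>i\<in>I - {k}. B l i * x i)" for l
      unfolding y B_def s_def by (simp add: sum_distrib_left sum_subtractf algebra_simps)
    then have "(\<Sum>i\<in>I. A l i * y i) = 0" if "l \<in> J" for l using x(2)[OF that] by simp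
    moreover have "(\<Sum>i\<in>I. A j i * y i) = 0" unfolding y by (simp add: s_def)
    moreover have "\<exists>i\<in>I. y i \<noteq> 0" using x(1) k by (auto simp: y_def)
    ultimately show ?thesis by (intro exI[of _ y]) auto
  qed
qed

text \<open>
  The Laplacian with the sign that makes subharmonic mean nonnegative.
\<close>

definition laplacian :: "'a set set \<Rightarrow> ('a \<Rightarrow> int) \<Rightarrow> 'a \<Rightarrow> int" where
  "laplacian E c v = (\<Sum>w\<in>neighbors E v. c w - c v)"

definition laplacian_coeff :: "'a set set \<Rightarrow> 'a \<Rightarrow> 'a \<Rightarrow> int" where
  "laplacian_coeff E v w =
     (if w \<in> neighbors E v then 1 else 0) - (if w = v then int (card (neighbors E v)) else 0)"

lemma neighbors_sym: "w \<in> neighbors E v \<longleftrightarrow> v \<in> neighbors E w"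
  by (simp add: neighbors_def insert_commute)

lemma neighbors_subset:
  assumes "finite_graph V E"
  shows "neighbors E v \<subseteq> V"
  using assms by (auto simp: neighbors_def finite_graph_def)

lemma finite_neighbors:
  assumes "finite_graph V E"
  shows "finite (neighbors E v)"
  using finite_subset[OF neighbors_subset[OF assms]] assms by (simp add: finite_graph_def)

lemma laplacian_eq_sum:
  assumes "finite_graph V E" "v \<in> V"
  shows "laplacian E c v = (\<Sum>w\<in>V. laplacian_coeff E v w * c w)"
proof -
  have V: "finite V" using assms by (simp add: finite_graph_def)
  have "(\<Sum>w\<in>V. laplacian_coeff E v w * c w)
      = (\<Sum>w\<in>V. (if w \<in> neighbors E v then c w else 0))
        - (\<Sum>w\<in>V. (if w = v then int (card (neighbors E v)) * c v else 0))"
    unfolding sum_subtractf[symmetric]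
    by (intro sum.cong) (auto simp: laplacian_coeff_def algebra_simps)
  also have "(\<Sum>w\<in>V. (if w \<in> neighbors E v then c w else 0)) = (\<Sum>w\<in>neighbors E v. c w)"
    using V neighbors_subset[OF assms(1), of v]
    by (simp add: sum.inter_restrict[symmetric] Int_absorb1)
  also have "(\<Sum>w\<in>V. (if w = v then int (card (neighbors E v)) * c v else 0))
      = int (card (neighbors E v)) * c v"
    using V assms(2) by simp
  finally show ?thesis by (simp add: laplacian_def sum_subtractf)
qed

lemma laplacian_cong:
  assumes "finite_graph V E" "v \<in> V" "\<And>w. w \<in> V \<Longrightarrow> c w = d w + k"
  shows "laplacian E c v = laplacian E d v"
  unfolding laplacian_def using assms neighbors_subset[OF assms(1), of v]
  by (intro sum.cong) auto

lemma laplacian_scale: "laplacian E (\<lambda>v. k * c v) v = k * laplacian E c v"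
  by (simp add: laplacian_def sum_distrib_left right_diff_distrib)

lemma sum_laplacian:
  assumes "finite_graph V E"
  shows "(\<Sum>v\<in>V. laplacian E c v) = 0"
proof -
  have V: "finite V" using assms by (simp add: finite_graph_def)
  define f where "f v w = (if w \<in> neighbors E v then c w - c v else 0)" for v w
  have e: "laplacian E c v = (\<Sum>w\<in>V. f v w)" for v
    using V neighbors_subset[OF assms, of v]
    by (simp add: f_def laplacian_def sum.inter_restrict[symmetric] Int_absorb1)
  have "(\<Sum>v\<in>V. \<Sum>w\<in>V. f v w) = (\<Sum>w\<in>V. \<Sum>v\<in>V. f v w)" by (rule sum.swap)
  also have "\<dots> = (\<Sum>w\<in>V. \<Sum>v\<in>V. - f w v)"
    by (intro sum.cong refl) (auto simp: f_def neighbors_sym)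
  also have "\<dots> = - (\<Sum>v\<in>V. \<Sum>w\<in>V. f v w)" by (simp add: sum_negf)
  finally show ?thesis by (simp add: e)
qed

text \<open>
  Maximum principle: the neighbors of a harmonic vertex that attains the maximum attain it, so the
  maximum propagates along paths until \<open>q\<close> is reached.
\<close>

lemma harmonic_le_boundary:
  assumes G: "finite_graph V E" "connected_graph V E" and q: "q \<in> V"
    and harm: "\<And>v. v \<in> V - {q} \<Longrightarrow> laplacian E c v = 0" and v: "v \<in> V"
  shows "c v \<le> c q"
proof -
  have V: "finite V" using G by (simp add: finite_graph_def)
  have max: "c w \<le> Max (c ` V)" if "w \<in> V" for w using V that by simp
  have "Max (c ` V) \<in> c ` V" using V q by (intro Max_in) auto
  then obtain x where x: "x \<in> V" "c x = Max (c ` V)" by auto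
  have reach: "c y = c x \<or> c q = c x" if "(\<lambda>x y. {x, y} \<in> E)\<^sup>*\<^sup>* x y" for y
    using that
  proof (induction rule: rtranclp_induct)
    case (step y z)
    show ?case
    proof (cases "c q = c x")
      case False
      then have cy: "c y = c x" and yq: "y \<noteq> q" using step by auto
      have yV: "y \<in> V" and z: "z \<in> neighbors E y"
        using step G by (auto simp: finite_graph_def neighbors_def)
      have le: "0 \<le> c y - c w" if "w \<in> neighbors E y" for w
        using max[of w] that x cy neighbors_subset[OF G(1), of y] by auto
      have "(\<Sum>w\<in>neighbors E y. c y - c w) = 0"
        using harm[of y] yV yq by (simp add: laplacian_def sum_subtractf)
      then have "c y - c z = 0"
        using sum_nonneg_eq_0_iff[of "neighbors E y" "\<lambda>w. c y - c w"] le z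
          finite_neighbors[OF G(1)] by blast
      then show ?thesis using cy by simp
    qed simp
  qed simp
  have "(\<lambda>x y. {x, y} \<in> E)\<^sup>*\<^sup>* x q" using G(2) x q by (simp add: connected_graph_def)
  from reach[OF this] show ?thesis using max[OF v] x by simp
qed

lemma vertex_orientation_cases:
  assumes "\<epsilon> \<in> vertex_orientations V" "v \<in> V"
  shows "\<epsilon> v = 1 \<or> \<epsilon> v = -1"
  using assms by (auto simp: vertex_orientations_def PiE_def Pi_def)

text \<open>
  The values of a Laplacian sum to 0, so a constant pattern of signs is impossible; every other pattern
  occurs. Let \<open>p\<close>, \<open>q\<close> be vertices with signs 1 and -1. By the maximum principle the Laplacian at the
  vertices other than \<open>q\<close> determines a function that vanishes at \<open>q\<close>, so that its values there can be
  prescribed up to a common factor. A value at \<open>p\<close> that exceeds the number of other negative vertices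
  then forces a negative value at \<open>q\<close>.
\<close>

lemma laplacian_sign_pattern:
  assumes G: "finite_graph V E" "connected_graph V E"
    and \<epsilon>: "\<epsilon> \<in> vertex_orientations V" "nonconstant V \<epsilon>"
  shows "\<exists>c. \<forall>v\<in>V. 0 < \<epsilon> v * laplacian E c v"
proof -
  have V: "finite V" using G by (simp add: finite_graph_def)
  note val = vertex_orientation_cases[OF \<epsilon>(1)]
  obtain p q where p: "p \<in> V" "\<epsilon> p = 1" and q: "q \<in> V" "\<epsilon> q = -1"
    using \<epsilon>(2) val unfolding nonconstant_def by blast
  have pq: "p \<noteq> q" using p q by auto
  define y where "y v = (if v = p then int (card V) else \<epsilon> v)" for v
  \<comment> \<open>The unknown at \<open>q\<close> is free, as the function is to vanish there. It serves as the common factor.\<close>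
  define A where "A v i = (if i = q then - y v else laplacian_coeff E v i)" for v i
  have "card (V - {q}) < card V" using V q(1) by (rule card_Diff1_less)
  then obtain x where x: "\<exists>i\<in>V. x i \<noteq> 0" "\<And>v. v \<in> V - {q} \<Longrightarrow> (\<Sum>i\<in>V. A v i * x i) = 0"
    using homogeneous_system_nontrivial[of "V - {q}" V A] V by blast
  define d where "d = x(q := 0)"
  have lap: "laplacian E d v = x q * y v" if v: "v \<in> V - {q}" for v
  proof -
    have "(\<Sum>i\<in>V. A v i * x i) = - y v * x q + (\<Sum>i\<in>V - {q}. A v i * x i)"
      using V q by (simp add: sum.remove[of V q] A_def)
    also have "(\<Sum>i\<in>V - {q}. A v i * x i) = (\<Sum>i\<in>V - {q}. laplacian_coeff E v i * d i)"
      by (intro sum.cong) (auto simp: A_def d_def)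
    also have "\<dots> = (\<Sum>i\<in>V. laplacian_coeff E v i * d i)"
      using V q by (simp add: sum.remove[of V q] d_def)
    also have "\<dots> = laplacian E d v" using laplacian_eq_sum[OF G(1)] v by simp
    finally show ?thesis using x(2)[OF v] by (simp add: mult.commute)
  qed
  have xq: "x q \<noteq> 0"
  proof
    assume 0: "x q = 0"
    have "d v = 0" if "v \<in> V" for v
    proof (rule antisym)
      have dq: "d q = 0" by (simp add: d_def)
      show "d v \<le> 0" using harmonic_le_boundary[OF G q(1) _ that, of d] lap 0 dq by simp
      have "laplacian E (\<lambda>v. (-1) * d v) v = 0" if "v \<in> V - {q}" for v
        unfolding laplacian_scale using lap[OF that] 0 by simp
      from harmonic_le_boundary[OF G q(1) this that] show "0 \<le> d v" using dq by simp
    qed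
    then show False using x(1) 0 by (metis d_def fun_upd_other)
  qed
  define c where "c v = sgn (x q) * d v" for v
  have c: "laplacian E c v = \<bar>x q\<bar> * y v" if "v \<in> V - {q}" for v
    unfolding c_def laplacian_scale lap[OF that] by (simp add: abs_sgn mult_ac)
  have "0 < \<epsilon> v * laplacian E c v" if v: "v \<in> V - {q}" for v
  proof -
    have "card V > 0" using V q by (auto simp: card_gt_0_iff)
    then have "0 < \<epsilon> v * y v" using val[of v] v p by (auto simp: y_def)
    then have "0 < \<bar>x q\<bar> * (\<epsilon> v * y v)" using xq by simp
    then show ?thesis using c[OF v] by (simp add: mult_ac)
  qed
  moreover have "0 < \<epsilon> q * laplacian E c q"
  proof -
    have "laplacian E c q = - (\<Sum>v\<in>V - {q}. laplacian E c v)"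
      using sum_laplacian[OF G(1), of c] V q by (simp add: sum.remove[of V q])
    also have "(\<Sum>v\<in>V - {q}. laplacian E c v) = \<bar>x q\<bar> * (\<Sum>v\<in>V - {q}. y v)"
      unfolding sum_distrib_left by (intro sum.cong) (auto simp: c)
    finally have e: "\<epsilon> q * laplacian E c q = \<bar>x q\<bar> * (\<Sum>v\<in>V - {q}. y v)" using q by simp
    have "(\<Sum>v\<in>V - {q}. y v) = int (card V) + (\<Sum>v\<in>V - {q} - {p}. \<epsilon> v)"
      using V p pq by (simp add: sum.remove[of "V - {q}" p] y_def)
    moreover have "(\<Sum>v\<in>V - {q} - {p}. - 1) \<le> (\<Sum>v\<in>V - {q} - {p}. \<epsilon> v)"
      using val by (intro sum_mono) force
    moreover have "card (V - {q} - {p}) < card V" using V q by (intro psubset_card_mono) auto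
    ultimately have "0 < (\<Sum>v\<in>V - {q}. y v)" by simp
    then show ?thesis unfolding e using xq by simp
  qed
  ultimately show ?thesis by blast
qed

section \<open>Colorings with a prescribed sign pattern\<close>

definition region :: "nat \<Rightarrow> 'a set \<Rightarrow> 'a set set \<Rightarrow> ('a \<Rightarrow> int) \<Rightarrow> nat \<Rightarrow> ('a \<Rightarrow> nat) set" where
  "region s V E \<epsilon> m =
     {c \<in> colorings V m. \<forall>v\<in>V. int s \<le> \<epsilon> v * laplacian E (\<lambda>w. int (c w)) v}"

text \<open>
  The coordinates are the colors, at \<open>Some v\<close>, and at \<open>None\<close> the slack that brings the sum of all
  coordinates to \<open>card V * T\<close>. This sum serves as the height, and the upper bound \<open>T\<close> for a color
  becomes a homogeneous condition: \<open>card V\<close> times the color is at most the sum of all coordinates.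
\<close>

definition region_forms ::
  "'a set \<Rightarrow> 'a set set \<Rightarrow> ('a \<Rightarrow> int) \<Rightarrow> bool \<times> 'a \<Rightarrow> 'a option \<Rightarrow> int" where
  "region_forms V E \<epsilon> k i =
     (if fst k then (case i of None \<Rightarrow> 0 | Some w \<Rightarrow> \<epsilon> (snd k) * laplacian_coeff E (snd k) w)
      else 1 - (if i = Some (snd k) then int (card V) else 0))"

abbreviation "coords V \<equiv> insert None (Some ` V)"

abbreviation "region_cone s V E \<epsilon> \<equiv> cone s (coords V) (region_forms V E \<epsilon>) (UNIV \<times> V)"

abbreviation "region_slice s V E \<epsilon> \<equiv>
  slice s (coords V) (\<lambda>_. 1) (region_forms V E \<epsilon>) (UNIV \<times> V)"

lemma linform_coords:
  assumes "finite V"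
  shows "linform (coords V) h a = h None * int (a None) + (\<Sum>v\<in>V. h (Some v) * int (a (Some v)))"
  using assms by (simp add: linform_def sum.reindex image_iff)

lemma linform_laplacian:
  assumes "finite_graph V E" "v \<in> V"
  shows "linform (coords V) (region_forms V E \<epsilon> (True, v)) a
    = \<epsilon> v * laplacian E (\<lambda>w. int (a (Some w))) v"
  using assms
  by (simp add: linform_coords finite_graph_def region_forms_def laplacian_eq_sum[OF assms]
      sum_distrib_left mult_ac)

lemma linform_bound:
  assumes "finite V" "v \<in> V"
  shows "linform (coords V) (region_forms V E \<epsilon> (False, v)) a
    = linform (coords V) (\<lambda>_. 1) a - int (card V) * int (a (Some v))"
proof -
  have "(\<Sum>w\<in>V. (1 - (if w = v then int (card V) else 0)) * int (a (Some w)))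
      = (\<Sum>w\<in>V. int (a (Some w)) - (if w = v then int (card V) * int (a (Some v)) else 0))"
    by (intro sum.cong) (auto simp: algebra_simps)
  also have "\<dots> = (\<Sum>w\<in>V. int (a (Some w))) - int (card V) * int (a (Some v))"
    using assms by (simp add: sum_subtractf)
  finally show ?thesis
    using assms by (simp add: linform_coords region_forms_def)
qed

lemma region_cone_iff:
  assumes "finite_graph V E"
  shows "a \<in> region_cone s V E \<epsilon> \<longleftrightarrow>
    s \<le> a None \<and> (\<forall>v\<in>V. s \<le> a (Some v)) \<and> (\<forall>v. v \<notin> V \<longrightarrow> a (Some v) = 0) \<and>
    (\<forall>v\<in>V. int s \<le> linform (coords V) (\<lambda>_. 1) a - int (card V) * int (a (Some v))) \<and>
    (\<forall>v\<in>V. int s \<le> \<epsilon> v * laplacian E (\<lambda>w. int (a (Some w))) v)"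
proof -
  have V: "finite V" using assms by (simp add: finite_graph_def)
  have "(\<forall>i. i \<notin> coords V \<longrightarrow> a i = 0) \<longleftrightarrow> (\<forall>v. v \<notin> V \<longrightarrow> a (Some v) = 0)"
    by (auto simp: split_option_all image_iff)
  moreover have "(UNIV :: bool set) \<times> V = {False} \<times> V \<union> {True} \<times> V" by auto
  then have "(\<forall>k\<in>UNIV \<times> V. int s \<le> linform (coords V) (region_forms V E \<epsilon> k) a) \<longleftrightarrow>
      (\<forall>v\<in>V. int s \<le> linform (coords V) (region_forms V E \<epsilon> (False, v)) a) \<and>
      (\<forall>v\<in>V. int s \<le> linform (coords V) (region_forms V E \<epsilon> (True, v)) a)"
    by (auto simp: ball_Un)
  ultimately show ?thesis
    unfolding cone_def by (auto simp: linform_bound[OF V] linform_laplacian[OF assms])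
qed

lemma region_slice_iff:
  assumes G: "finite_graph V E" "V \<noteq> {}" and s: "s \<le> 1" and T: "T = int m + 2 * int s - 1"
  shows "a \<in> region_slice s V E \<epsilon> (int (card V) * T) \<longleftrightarrow>
    int (a None) = (\<Sum>v\<in>V. T - int (a (Some v))) \<and> (\<forall>v. v \<notin> V \<longrightarrow> a (Some v) = 0) \<and>
    (\<forall>v\<in>V. s \<le> a (Some v) \<and> int (a (Some v)) + int s \<le> T) \<and>
    (\<forall>v\<in>V. int s \<le> \<epsilon> v * laplacian E (\<lambda>w. int (a (Some w))) v)"
proof -
  have V: "finite V" using G by (simp add: finite_graph_def)
  have n: "1 \<le> int (card V)" using V G by (simp add: Suc_le_eq card_gt_0_iff)
  have sum: "linform (coords V) (\<lambda>_. 1) a = int (card V) * T \<longleftrightarrow>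
      int (a None) = (\<Sum>v\<in>V. T - int (a (Some v)))"
    using V by (auto simp: linform_coords sum_subtractf)
  have bound: "int s \<le> int (card V) * T - int (card V) * x \<longleftrightarrow> x + int s \<le> T" for x
  proof (cases "s = 0")
    case False
    then have "s = 1" using s by simp
    moreover have "1 \<le> int (card V) * T - int (card V) * x \<longleftrightarrow> 0 < int (card V) * (T - x)"
      by (auto simp: right_diff_distrib)
    moreover have "0 < int (card V) * (T - x) \<longleftrightarrow> x < T"
      using n by (simp add: zero_less_mult_iff)
    ultimately show ?thesis by auto
  qed (use n in simp)
  have slack: "s \<le> a None"
    if e: "int (a None) = (\<Sum>v\<in>V. T - int (a (Some v)))"
      and b: "\<forall>v\<in>V. int (a (Some v)) + int s \<le> T"
  proof -
    have "(\<Sum>v\<in>V. int s) \<le> int (a None)" unfolding e using b by (intro sum_mono) auto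
    moreover have "1 * int s \<le> int (card V) * int s" using n by (intro mult_right_mono) auto
    ultimately show ?thesis by simp
  qed
  show ?thesis
    unfolding slice_def mem_Collect_eq region_cone_iff[OF G(1)]
    using sum bound slack by auto
qed

text \<open>
  The colors \<open>1, \<dots>, m\<close> are the integers strictly between 0 and \<open>m + 1\<close>; shifted by 1 they are the
  integers from 0 to \<open>m - 1\<close>. The Laplacian ignores the shift. This turns the argument \<open>m\<close> into
  \<open>m + 1\<close> for the interior and into \<open>m - 1\<close> for the closed cone, and \<open>- (m - 1) = (- m) + 1\<close>, so that
  reciprocity relates \<open>m\<close> and \<open>- m\<close>.
\<close>

lemma card_region:
  assumes G: "finite_graph V E" "V \<noteq> {}" and s: "s \<le> 1"
  shows "card (region s V E \<epsilon> m)
    = card (region_slice s V E \<epsilon> (int (card V) * (int m + 2 * int s - 1)))"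
proof -
  define T where "T = int m + 2 * int s - 1"
  note iff = region_slice_iff[OF G s T_def]
  define f where "f c = (\<lambda>i. case i of None \<Rightarrow> nat (\<Sum>v\<in>V. T - (int (c v) + int s - 1))
    | Some v \<Rightarrow> if v \<in> V then c v + s - 1 else 0)" for c :: "'a \<Rightarrow> nat"
  define g where "g a = restrict (\<lambda>v. a (Some v) + 1 - s) V" for a :: "'a option \<Rightarrow> nat"
  have lap_f: "laplacian E (\<lambda>w. int (f c (Some w))) v = laplacian E (\<lambda>w. int (c w)) v"
    if "c \<in> colorings V m" "v \<in> V" for c v
    using that by (intro laplacian_cong[OF G(1), where k = "int s - 1"])
      (auto simp: f_def colorings_def PiE_def Pi_def of_nat_diff)
  have lap_g: "laplacian E (\<lambda>w. int (g a w)) v = laplacian E (\<lambda>w. int (a (Some w))) v"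
    if "v \<in> V" for a v
    using that s by (intro laplacian_cong[OF G(1), where k = "1 - int s"])
      (auto simp: g_def of_nat_diff)
  have "bij_betw f (region s V E \<epsilon> m) (region_slice s V E \<epsilon> (int (card V) * T))"
  proof (rule bij_betw_byWitness[where f' = g])
    show "\<forall>c\<in>region s V E \<epsilon> m. g (f c) = c"
    proof
      fix c assume "c \<in> region s V E \<epsilon> m"
      then have c: "\<And>v. v \<in> V \<Longrightarrow> 1 \<le> c v" "\<And>v. v \<notin> V \<Longrightarrow> c v = undefined"
        by (auto simp: region_def colorings_def PiE_def Pi_def extensional_def)
      show "g (f c) = c"
      proof
        fix v
        show "g (f c) v = c v" using c[of v] by (cases "v \<in> V") (auto simp: g_def f_def)
      qed
    qed
    show "\<forall>a\<in>region_slice s V E \<epsilon> (int (card V) * T). f (g a) = a"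
    proof
      fix a assume "a \<in> region_slice s V E \<epsilon> (int (card V) * T)"
      then have a: "int (a None) = (\<Sum>v\<in>V. T - int (a (Some v)))"
        "\<And>v. v \<notin> V \<Longrightarrow> a (Some v) = 0" by (auto simp: iff)
      have "f (g a) None = nat (\<Sum>v\<in>V. T - int (a (Some v)))"
        using s by (auto simp: f_def g_def of_nat_diff intro!: arg_cong[where f = nat] sum.cong)
      then have "f (g a) None = a None" unfolding a(1)[symmetric] by simp
      moreover have "f (g a) (Some v) = a (Some v)" for v
        using a(2) s by (auto simp: f_def g_def)
      ultimately show "f (g a) = a" by (metis ext option.exhaust)
    qed
    show "f ` region s V E \<epsilon> m \<subseteq> region_slice s V E \<epsilon> (int (card V) * T)"
    proof
      fix a assume "a \<in> f ` region s V E \<epsilon> m"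
      then obtain c where c: "c \<in> colorings V m" "a = f c"
        "\<And>v. v \<in> V \<Longrightarrow> int s \<le> \<epsilon> v * laplacian E (\<lambda>w. int (c w)) v" by (auto simp: region_def)
      have range: "1 \<le> c v" "c v \<le> m" if "v \<in> V" for v
        using c(1) that by (auto simp: colorings_def PiE_def Pi_def)
      have fv: "int (f c (Some v)) = int (c v) + int s - 1" if "v \<in> V" for v
        using range[OF that] that by (simp add: f_def of_nat_diff)
      have "0 \<le> (\<Sum>v\<in>V. T - (int (c v) + int s - 1))"
        using range s by (intro sum_nonneg) (force simp: T_def)
      then have "int (f c None) = (\<Sum>v\<in>V. T - int (f c (Some v)))"
        using fv by (simp add: f_def)
      moreover have "s \<le> f c (Some v) \<and> int (f c (Some v)) + int s \<le> T" if "v \<in> V" for v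
        using fv[OF that] range[OF that] by (simp add: T_def)
      ultimately show "a \<in> region_slice s V E \<epsilon> (int (card V) * T)"
        unfolding iff c(2) using lap_f[OF c(1)] c(3) by (auto simp: f_def)
    qed
    show "g ` region_slice s V E \<epsilon> (int (card V) * T) \<subseteq> region s V E \<epsilon> m"
    proof
      fix c assume "c \<in> g ` region_slice s V E \<epsilon> (int (card V) * T)"
      then obtain a where a: "a \<in> region_slice s V E \<epsilon> (int (card V) * T)" "c = g a" by blast
      have "1 \<le> g a v \<and> g a v \<le> m" if "v \<in> V" for v
        using a(1) that s unfolding iff by (force simp: g_def T_def)
      then have "g a \<in> colorings V m" by (simp add: colorings_def g_def PiE_def Pi_def)
      then show "c \<in> region s V E \<epsilon> m"
        using a lap_g unfolding iff by (simp add: region_def)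
    qed
  qed
  then show ?thesis by (simp add: bij_betw_same_card T_def)
qed

lemma region_cone_nonempty:
  assumes G: "finite_graph V E" "connected_graph V E"
    and \<epsilon>: "\<epsilon> \<in> vertex_orientations V" "nonconstant V \<epsilon>"
  shows "region_cone 1 V E \<epsilon> \<noteq> {}"
proof -
  have V: "finite V" "V \<noteq> {}" using G by (auto simp: finite_graph_def connected_graph_def)
  obtain c where c: "\<And>v. v \<in> V \<Longrightarrow> 0 < \<epsilon> v * laplacian E c v"
    using laplacian_sign_pattern[OF G \<epsilon>] by blast
  define b where "b = (\<Sum>v\<in>V. \<bar>c v\<bar>)"
  have b: "\<bar>c v\<bar> \<le> b" if "v \<in> V" for v
    unfolding b_def using that V by (intro member_le_sum) auto
  define d where "d = restrict (\<lambda>v. nat (c v + b + 1)) V"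
  define m where "m = nat (2 * b + 1)"
  have d: "int (d v) = c v + (b + 1)" if "v \<in> V" for v
    using b[OF that] that by (simp add: d_def)
  have "d \<in> region 1 V E \<epsilon> m"
    unfolding region_def
  proof (intro CollectI conjI ballI)
    have "1 \<le> d v \<and> d v \<le> m" if "v \<in> V" for v
      using b[OF that] d[OF that] by (auto simp: m_def)
    then show "d \<in> colorings V m" by (simp add: colorings_def d_def PiE_def Pi_def)
    show "int 1 \<le> \<epsilon> v * laplacian E (\<lambda>w. int (d w)) v" if "v \<in> V" for v
      using c[OF that] laplacian_cong[OF G(1) that d] by simp
  qed
  moreover have "finite (region 1 V E \<epsilon> m)"
    using V by (simp add: region_def colorings_def finite_PiE)
  ultimately have "card (region 1 V E \<epsilon> m) \<noteq> 0" by auto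
  then show ?thesis unfolding card_region[OF G(1) V(2) order_refl] slice_def by auto
qed

lemma region_reciprocity:
  assumes G: "finite_graph V E" "connected_graph V E"
    and \<epsilon>: "\<epsilon> \<in> vertex_orientations V" "nonconstant V \<epsilon>"
  shows "\<exists>q. quasipolynomial q \<and> (\<forall>m::nat. m \<ge> 1 \<longrightarrow>
    q (int m) = real (card (region 1 V E \<epsilon> m)) \<and>
    (-1) ^ card V * q (- int m) = real (card (region 0 V E \<epsilon> m)))"
proof -
  have V: "finite V" "V \<noteq> {}" using G by (auto simp: finite_graph_def connected_graph_def)
  have n: "0 < int (card V)" using V by (simp add: card_gt_0_iff)
  have cardI: "card (coords V) = Suc (card V)" using V by (simp add: card_image image_iff)
  have "reciprocal (coords V) (\<lambda>_. 1) (region_forms V E \<epsilon>) (UNIV \<times> V)"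
    using V by (intro reciprocal_cone region_cone_nonempty[OF G \<epsilon>]) auto
  then obtain q where q: "quasipolynomial q"
    and pos: "\<And>t. t > 0 \<Longrightarrow> q t = real (card (region_slice 1 V E \<epsilon> t))"
    and neg: "\<And>t. t \<ge> 0 \<Longrightarrow> (-1) ^ card V * q (- t) = real (card (region_slice 0 V E \<epsilon> t))"
    unfolding reciprocal_def cardI by auto
  define r where "r m = q (int (card V) * m + int (card V))" for m
  have "quasipolynomial r" unfolding r_def by (rule quasipolynomial_affine[OF q])
  moreover have "r (int m) = real (card (region 1 V E \<epsilon> m))" for m
  proof -
    have "0 < int (card V) * (int m + 1)" using n by simp
    from pos[OF this] show ?thesis
      unfolding card_region[OF G(1) V(2) order_refl] by (simp add: r_def algebra_simps)
  qed
  moreover have "(-1) ^ card V * r (- int m) = real (card (region 0 V E \<epsilon> m))" if "m \<ge> 1" for m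
  proof -
    have "0 \<le> int (card V) * (int m - 1)" using that by simp
    from neg[OF this] show ?thesis
      unfolding card_region[OF G(1) V(2) zero_le_one] by (simp add: r_def algebra_simps)
  qed
  ultimately show ?thesis by blast
qed

section \<open>Nowhere-harmonic colorings\<close>

text \<open>
  The Laplacian is the degree times the difference of average and value. At an isolated vertex both
  vanish.
\<close>

lemma neighbor_average_laplacian:
  assumes "finite_graph V E"
  shows "real (c v) = neighbor_average E c v \<longleftrightarrow> laplacian E (\<lambda>w. int (c w)) v = 0"
    and "subharmonic_at E c v \<longleftrightarrow> 0 \<le> laplacian E (\<lambda>w. int (c w)) v"
    and "superharmonic_at E c v \<longleftrightarrow> laplacian E (\<lambda>w. int (c w)) v \<le> 0"
proof -
  let ?L = "laplacian E (\<lambda>w. int (c w)) v"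
  let ?d = "real (card (neighbors E v))"
  have "sgn (neighbor_average E c v - real (c v)) = real_of_int (sgn ?L)"
  proof (cases "neighbors E v = {}")
    case True
    then show ?thesis by (simp add: neighbor_average_def laplacian_def)
  next
    case False
    then have d: "?d > 0" using finite_neighbors[OF assms] by (simp add: card_gt_0_iff)
    have "real_of_int ?L = ?d * (neighbor_average E c v - real (c v))"
      using d False
      by (simp add: neighbor_average_def laplacian_def sum_subtractf right_diff_distrib)
    then have "sgn (real_of_int ?L) = sgn (neighbor_average E c v - real (c v))"
      using d by (simp add: sgn_mult)
    then show ?thesis by (simp add: sgn_if split: if_splits)
  qed
  then show "real (c v) = neighbor_average E c v \<longleftrightarrow> ?L = 0"
    "subharmonic_at E c v \<longleftrightarrow> 0 \<le> ?L" "superharmonic_at E c v \<longleftrightarrow> ?L \<le> 0"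
    unfolding subharmonic_at_def superharmonic_at_def
    by (auto simp: sgn_if split: if_splits)
qed

abbreviation "nonconstant_orientations V \<equiv> {\<epsilon> \<in> vertex_orientations V. nonconstant V \<epsilon>}"

lemma region_closed_eq:
  assumes "finite_graph V E" "\<epsilon> \<in> vertex_orientations V"
  shows "region 0 V E \<epsilon> m = {c \<in> colorings V m. compatible V E c \<epsilon>}"
proof -
  have "0 \<le> \<epsilon> v * laplacian E (\<lambda>w. int (c w)) v \<longleftrightarrow>
      (\<epsilon> v = 1 \<longrightarrow> subharmonic_at E c v) \<and> (\<epsilon> v = -1 \<longrightarrow> superharmonic_at E c v)"
    if "v \<in> V" for c v
    using vertex_orientation_cases[OF assms(2) that]
    by (auto simp: neighbor_average_laplacian[OF assms(1)])
  then show ?thesis by (auto simp: region_def compatible_def)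
qed

lemma nowhere_harmonic_eq_Union_region:
  assumes G: "finite_graph V E" and V: "V \<noteq> {}"
  shows "{c \<in> colorings V m. nowhere_harmonic V E c}
    = (\<Union>\<epsilon>\<in>nonconstant_orientations V. region 1 V E \<epsilon> m)"
proof (intro equalityI subsetI)
  fix c assume c: "c \<in> {c \<in> colorings V m. nowhere_harmonic V E c}"
  let ?L = "laplacian E (\<lambda>w. int (c w))"
  have L: "?L v \<noteq> 0" if "v \<in> V" for v
    using c that by (simp add: nowhere_harmonic_def neighbor_average_laplacian[OF G])
  define \<epsilon> where "\<epsilon> = restrict (\<lambda>v. sgn (?L v)) V"
  have fin: "finite V" using G by (simp add: finite_graph_def)
  have zero: "(\<Sum>v\<in>V. ?L v) = 0" using sum_laplacian[OF G] .
  have "\<epsilon> \<in> vertex_orientations V"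
    using L by (auto simp: \<epsilon>_def vertex_orientations_def sgn_if)
  moreover have "nonconstant V \<epsilon>"
    unfolding nonconstant_def
  proof (intro conjI notI)
    assume "\<forall>v\<in>V. \<epsilon> v = 1"
    then have "0 < (\<Sum>v\<in>V. ?L v)"
      using fin V by (intro sum_pos) (auto simp: \<epsilon>_def sgn_if split: if_splits)
    then show False using zero by simp
  next
    assume "\<forall>v\<in>V. \<epsilon> v = -1"
    then have "0 < (\<Sum>v\<in>V. - ?L v)"
      using fin V by (intro sum_pos) (auto simp: \<epsilon>_def sgn_if split: if_splits)
    then show False using zero by (simp add: sum_negf)
  qed
  moreover have "int 1 \<le> \<epsilon> v * ?L v" if "v \<in> V" for v
    using L[OF that] that by (auto simp: \<epsilon>_def sgn_if)
  then have "c \<in> region 1 V E \<epsilon> m"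
    using c by (simp add: region_def)
  ultimately show "c \<in> (\<Union>\<epsilon>\<in>nonconstant_orientations V. region 1 V E \<epsilon> m)" by blast
next
  fix c assume "c \<in> (\<Union>\<epsilon>\<in>nonconstant_orientations V. region 1 V E \<epsilon> m)"
  then show "c \<in> {c \<in> colorings V m. nowhere_harmonic V E c}"
    by (force simp: region_def nowhere_harmonic_def neighbor_average_laplacian[OF G])
qed

lemma region_open_disjoint:
  assumes "\<epsilon> \<in> vertex_orientations V" "\<delta> \<in> vertex_orientations V" "\<epsilon> \<noteq> \<delta>"
  shows "region 1 V E \<epsilon> m \<inter> region 1 V E \<delta> m = {}"
proof -
  obtain v where v: "v \<in> V" "\<epsilon> v \<noteq> \<delta> v"
    using assms by (metis PiE_ext vertex_orientations_def)
  then have "\<epsilon> v = - \<delta> v"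
    using vertex_orientation_cases[OF assms(1) v(1)] vertex_orientation_cases[OF assms(2) v(1)]
    by auto
  then show ?thesis using v(1) by (force simp: region_def)
qed

lemma finite_colorings: "finite V \<Longrightarrow> finite (colorings V m)"
  by (simp add: colorings_def finite_PiE)

lemma finite_vertex_orientations: "finite V \<Longrightarrow> finite (vertex_orientations V)"
  by (simp add: vertex_orientations_def finite_PiE)

lemma hbar_eq_sum_region:
  assumes G: "finite_graph V E" and V: "V \<noteq> {}"
  shows "hbar V E m = (\<Sum>\<epsilon>\<in>nonconstant_orientations V. card (region 1 V E \<epsilon> m))"
  unfolding hbar_def nowhere_harmonic_eq_Union_region[OF G V]
proof (rule card_UN_disjoint)
  have fin: "finite V" using G by (simp add: finite_graph_def)
  show "finite (nonconstant_orientations V)" using finite_vertex_orientations[OF fin] by simp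
  show "\<forall>\<epsilon>\<in>nonconstant_orientations V. finite (region 1 V E \<epsilon> m)"
    using finite_colorings[OF fin] by (simp add: region_def)
qed (use region_open_disjoint in blast)

lemma sum_beta_eq_sum_region:
  assumes G: "finite_graph V E"
  shows "(\<Sum>c\<in>colorings V m. beta V E c)
    = (\<Sum>\<epsilon>\<in>nonconstant_orientations V. card (region 0 V E \<epsilon> m))"
proof -
  have fin: "finite (colorings V m)" "finite (nonconstant_orientations V)"
    using G by (simp_all add: finite_graph_def finite_colorings finite_vertex_orientations)
  have "(\<Sum>c\<in>colorings V m. beta V E c)
      = (\<Sum>c\<in>colorings V m. \<Sum>\<epsilon>\<in>nonconstant_orientations V. if compatible V E c \<epsilon> then 1 else 0)"
    using fin(2) by (simp add: beta_def sum.inter_filter[symmetric] conj_assoc)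
  also have "\<dots> = (\<Sum>\<epsilon>\<in>nonconstant_orientations V.
      \<Sum>c\<in>colorings V m. if compatible V E c \<epsilon> then 1 else 0)"
    by (rule sum.swap)
  also have "\<dots> = (\<Sum>\<epsilon>\<in>nonconstant_orientations V. card (region 0 V E \<epsilon> m))"
    using fin(1) by (intro sum.cong refl)
      (simp add: region_closed_eq[OF G] sum.inter_filter[symmetric])
  finally show ?thesis .
qed

lemma hbar_quasi_eqI:
  assumes "quasipolynomial f" "\<And>m::nat. m \<ge> 1 \<Longrightarrow> f (int m) = real (hbar V E m)"
  shows "hbar_quasi V E = f"
  unfolding hbar_quasi_def
  by (rule the_equality) (use assms in \<open>auto intro!: quasipolynomial_eqI\<close>)

theorem theorem3p5:
  fixes V :: "'a set" and E :: "'a set set" and n m :: nat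
  assumes "finite_graph V E" and "connected_graph V E" and "card V = n" and "m > 0"
  shows "(-1) ^ n * hbar_quasi V E (- int m) = real (\<Sum>c\<in>colorings V m. beta V E c)"
proof -
  note G = assms(1,2)
  have V: "V \<noteq> {}" using G by (simp add: connected_graph_def)
  obtain q where quasi: "\<And>\<epsilon>. \<epsilon> \<in> nonconstant_orientations V \<Longrightarrow> quasipolynomial (q \<epsilon>)"
    and pos: "\<And>\<epsilon> m. \<epsilon> \<in> nonconstant_orientations V \<Longrightarrow> m \<ge> 1 \<Longrightarrow>
      q \<epsilon> (int m) = real (card (region 1 V E \<epsilon> m))"
    and neg: "\<And>\<epsilon> m. \<epsilon> \<in> nonconstant_orientations V \<Longrightarrow> m \<ge> 1 \<Longrightarrow>
      (-1) ^ card V * q \<epsilon> (- int m) = real (card (region 0 V E \<epsilon> m))"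
    using region_reciprocity[OF G] by (simp add: mem_Collect_eq) metis
  have "hbar_quasi V E = (\<lambda>t. \<Sum>\<epsilon>\<in>nonconstant_orientations V. q \<epsilon> t)"
  proof (rule hbar_quasi_eqI)
    show "quasipolynomial (\<lambda>t. \<Sum>\<epsilon>\<in>nonconstant_orientations V. q \<epsilon> t)"
      by (intro quasipolynomial_sum quasi)
    show "(\<Sum>\<epsilon>\<in>nonconstant_orientations V. q \<epsilon> (int m)) = real (hbar V E m)" if "m \<ge> 1" for m
      unfolding hbar_eq_sum_region[OF G(1) V] of_nat_sum
      using that by (intro sum.cong refl pos)
  qed
  then have "(-1) ^ n * hbar_quasi V E (- int m)
      = (\<Sum>\<epsilon>\<in>nonconstant_orientations V. (-1) ^ card V * q \<epsilon> (- int m))"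
    using assms(3) by (simp add: sum_distrib_left)
  also have "\<dots> = (\<Sum>\<epsilon>\<in>nonconstant_orientations V. real (card (region 0 V E \<epsilon> m)))"
    using assms(4) by (intro sum.cong refl neg) auto
  finally show ?thesis unfolding sum_beta_eq_sum_region[OF G(1)] by simp
qed

end
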